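(* Let $F$ be a graph and let $e$ be any edge of $F$. Then $\mathrm{th}(F)\le R(K_{\chi(F)},F\setminus e)$.
   Context: A hypergraph $\mathcal{H}$ is a Berge copy of a graph $G$ (Berge-$G$) if $V(G)\subseteq V(\mathcal{H})$ and there is a bijection $f:E(G)\to E(\mathcal{H})$ with $e\subseteq f(e)$ for every $e\in E(G)$; $G$ is then called the core. $\mathrm{ex}_r(n,\text{Berge-}F)$ denotes the maximum number of hyperedges in an $r$-uniform $n$-vertex hypergraph containing no Berge copy of $F$. It is known that for every graph $F$ there is an integer $r_0$ such that $\mathrm{ex}_r(n,\text{Berge-}F)=o(n^2)$ (as $n\to\infty$) for every $r\ge r_0$; the uniformity threshold $\mathrm{th}(F)$ is the smallest such $r_0$. $\chi(F)$ is the chromatic number, $F\setminus e$ is the graph obtained from $F$ by deleting the edge $e$, and $R(H,G)$ is the off-diagonal Ramsey number: the smallest $N$ such that every red/blue coloring of the edges of $K_N$ contains a blue copy of $H$ or a red copy of $G$. *)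

theory Defs
  imports Main "HOL-Library.Landau_Symbols"
begin

definition graph :: "'a set \<Rightarrow> 'a set set \<Rightarrow> bool" where
  "graph V E \<longleftrightarrow> finite V \<and> (\<forall>e\<in>E. e \<subseteq> V \<and> card e = 2)"

definition chromatic_number :: "'a set \<Rightarrow> 'a set set \<Rightarrow> nat" where
  "chromatic_number V E = (LEAST k. \<exists>c. c ` V \<subseteq> {0..<k} \<and>
      (\<forall>e\<in>E. \<forall>u\<in>e. \<forall>v\<in>e. u \<noteq> v \<longrightarrow> c u \<noteq> c v))"

definition complete_graph_edges :: "nat \<Rightarrow> nat set set" where
  "complete_graph_edges k = {e. e \<subseteq> {0..<k} \<and> card e = 2}"

text \<open>A red/blue colouring of the edges of K_N is a function col on 2-subsets of
  {0..<N}; col e = True means red, False means blue. A copy of the graph (V,E) in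
  colour b is an injective embedding of V into {0..<N} mapping every edge to an
  edge of colour b.\<close>
definition coloured_copy :: "nat \<Rightarrow> (nat set \<Rightarrow> bool) \<Rightarrow> bool \<Rightarrow> 'a set \<Rightarrow> 'a set set \<Rightarrow> bool" where
  "coloured_copy N col b V E \<longleftrightarrow> (\<exists>\<phi>. inj_on \<phi> V \<and> \<phi> ` V \<subseteq> {0..<N} \<and>
      (\<forall>e\<in>E. col (\<phi> ` e) = b))"

definition ramsey_number :: "'a set \<Rightarrow> 'a set set \<Rightarrow> 'b set \<Rightarrow> 'b set set \<Rightarrow> nat" where
  "ramsey_number VH EH VG EG = (LEAST N. \<forall>col :: nat set \<Rightarrow> bool.
      coloured_copy N col False VH EH \<or> coloured_copy N col True VG EG)"

definition uniform_hypergraph :: "nat \<Rightarrow> nat \<Rightarrow> nat set set \<Rightarrow> bool" where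
  "uniform_hypergraph r n H \<longleftrightarrow> (\<forall>h\<in>H. h \<subseteq> {0..<n} \<and> card h = r)"

definition contains_berge :: "'a set \<Rightarrow> 'a set set \<Rightarrow> nat \<Rightarrow> nat set set \<Rightarrow> bool" where
  "contains_berge V E n H \<longleftrightarrow> (\<exists>\<phi> f. inj_on \<phi> V \<and> \<phi> ` V \<subseteq> {0..<n} \<and>
      inj_on f E \<and> f ` E \<subseteq> H \<and> (\<forall>e\<in>E. \<phi> ` e \<subseteq> f e))"

definition ex_berge :: "nat \<Rightarrow> nat \<Rightarrow> 'a set \<Rightarrow> 'a set set \<Rightarrow> nat" where
  "ex_berge r n V E = Max {card H | H. uniform_hypergraph r n H \<and> \<not> contains_berge V E n H}"

definition uniformity_threshold :: "'a set \<Rightarrow> 'a set set \<Rightarrow> nat" where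
  "uniformity_threshold V E = (LEAST r0. \<forall>r\<ge>r0.
      (\<lambda>n. real (ex_berge r n V E)) \<in> o(\<lambda>n. real n ^ 2))"

end

theory Submission
  imports Defs "HOL-Library.Ramsey" "HOL-Library.Indicator_Function"
begin

text \<open>
  Let \<open>k = \<chi>(F)\<close> and let \<open>H\<close> be a Berge-\<open>F\<close>-free \<open>r\<close>-uniform hypergraph with
  \<open>r \<ge> R(K\<^sub>k, F - e)\<close>. Call a pair of vertices red if at least \<open>|E(F)|\<close> hyperedges contain it and
  blue otherwise. A red copy of \<open>F - e\<close> inside a hyperedge \<open>h\<close> would extend greedily to a Berge-\<open>F\<close>
  in which \<open>h\<close> plays the role of \<open>e\<close>; so every hyperedge \<open>h\<close> contains a blue clique, with vertices
  \<open>q h 0, \<dots>, q h (k - 1)\<close>. Every blue pair lies in a bounded number of these cliques.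

  If \<open>|H| > \<epsilon> n\<^sup>2\<close>, apply Szemeredi regularity simultaneously to the relations
  \<open>{(q h i, q h j) | h \<in> H}\<close>. Only few pairs are irregular, sparse or in small cells, and each kills a
  bounded number of cliques, so some clique survives; its vertices lie in \<open>k\<close> large cells that are
  pairwise dense and regular. Embed \<open>F\<close> greedily into these cells along a proper \<open>k\<close>-colouring,
  never placing three vertices into the same clique. Two placed vertices rule out only boundedly many
  positions, so this costs nothing, and it makes the hyperedges chosen for the edges of \<open>F\<close> distinct:
  \<open>H\<close> contains a Berge-\<open>F\<close> after all.
\<close>

section \<open>Block means and energy\<close>

text \<open>The conditional expectation of \<open>f\<close> under the uniform measure on
  \<open>Z\<close>. A partition is given by a labelling \<open>P\<close>, so passing to pairs or to
  finer partitions only changes the label.\<close>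

definition block_mean :: "'z set \<Rightarrow> ('z \<Rightarrow> 'l) \<Rightarrow> ('z \<Rightarrow> real) \<Rightarrow> 'z \<Rightarrow> real" where
  "block_mean Z P f z = (\<Sum>w | w \<in> Z \<and> P w = P z. f w) / card {w \<in> Z. P w = P z}"

lemma block_mean_cong: "P z = P w \<Longrightarrow> block_mean Z P f z = block_mean Z P f w"
  by (simp add: block_mean_def)

text \<open>Averaging over blocks is invisible to test functions that are constant on blocks: after
  swapping the double sum, each \<open>w\<close> is counted once for every point of its block, which
  cancels the denominator. Taking \<open>h\<close> to be the indicator of a union of blocks is the
  main use.\<close>

lemma sum_block_mean_mult:
  assumes fin: "finite Z"
    and h: "\<And>z w. z \<in> Z \<Longrightarrow> w \<in> Z \<Longrightarrow> P z = P w \<Longrightarrow> h z = h w"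
  shows "(\<Sum>z\<in>Z. block_mean Z P f z * h z) = (\<Sum>z\<in>Z. f z * h z)"
proof -
  let ?c = "\<lambda>z. real (card {w \<in> Z. P w = P z})"
  have "(\<Sum>z\<in>Z. block_mean Z P f z * h z)
      = (\<Sum>z\<in>Z. \<Sum>w | w \<in> Z \<and> P w = P z. f w * h w / ?c w)"
  proof (rule sum.cong[OF refl])
    fix z assume z: "z \<in> Z"
    have "block_mean Z P f z * h z = (\<Sum>w | w \<in> Z \<and> P w = P z. f w * h z / ?c z)"
      by (simp add: block_mean_def sum_distrib_right sum_divide_distrib)
    also have "\<dots> = (\<Sum>w | w \<in> Z \<and> P w = P z. f w * h w / ?c w)"
    proof (intro sum.cong refl)
      fix w assume "w \<in> {w \<in> Z. P w = P z}"
      then have "P w = P z" "h w = h z" using h[of w z] z by auto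
      then show "f w * h z / ?c z = f w * h w / ?c w" by (simp only:)
    qed
    finally show "block_mean Z P f z * h z = (\<Sum>w | w \<in> Z \<and> P w = P z. f w * h w / ?c w)" .
  qed
  also have "\<dots> = (\<Sum>w\<in>Z. \<Sum>z | z \<in> Z \<and> P w = P z. f w * h w / ?c w)"
    by (rule sum.swap_restrict[OF fin fin, of "\<lambda>z w. f w * h w / ?c w" "\<lambda>z w. P w = P z"])
  also have "\<dots> = (\<Sum>w\<in>Z. f w * h w)"
  proof (rule sum.cong[OF refl])
    fix w assume w: "w \<in> Z"
    have e: "{z \<in> Z. P w = P z} = {z \<in> Z. P z = P w}"
      by (intro Collect_cong conj_cong refl eq_commute)
    have "w \<in> {z \<in> Z. P z = P w}" using w by simp
    moreover have "finite {z \<in> Z. P z = P w}" using fin by simp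
    ultimately have "?c w \<noteq> 0" by (metis card_0_eq empty_iff of_nat_eq_0_iff)
    then show "(\<Sum>z | z \<in> Z \<and> P w = P z. f w * h w / ?c w) = f w * h w"
      by (simp add: e)
  qed
  finally show ?thesis .
qed

lemma block_mean_bounds:
  assumes "\<And>z. z \<in> Z \<Longrightarrow> 0 \<le> f z \<and> f z \<le> 1"
  shows "0 \<le> block_mean Z P f z" "block_mean Z P f z \<le> 1"
proof -
  show "0 \<le> block_mean Z P f z"
    using assms by (auto simp: block_mean_def intro!: divide_nonneg_nonneg sum_nonneg)
  have "(\<Sum>w | w \<in> Z \<and> P w = P z. f w) \<le> (\<Sum>w | w \<in> Z \<and> P w = P z. 1)"
    using assms by (intro sum_mono) auto
  then show "block_mean Z P f z \<le> 1"
    by (auto simp: block_mean_def divide_le_eq_1)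
qed

text \<open>The coarse mean is the orthogonal projection of the fine one. It is constant on the
  blocks of both partitions, so its product sums with \<open>f\<close>, with the fine mean and with
  itself all agree, and the cross term collapses.\<close>

lemma block_mean_pythagoras:
  assumes fin: "finite Z"
    and refine: "\<And>z w. z \<in> Z \<Longrightarrow> w \<in> Z \<Longrightarrow> Q z = Q w \<Longrightarrow> P z = P w"
  shows "(\<Sum>z\<in>Z. (block_mean Z Q f z - block_mean Z P f z)\<^sup>2)
       = (\<Sum>z\<in>Z. (block_mean Z Q f z)\<^sup>2) - (\<Sum>z\<in>Z. (block_mean Z P f z)\<^sup>2)"
proof -
  let ?g = "block_mean Z P f" and ?g' = "block_mean Z Q f"
  have "(\<Sum>z\<in>Z. ?g' z * ?g z) = (\<Sum>z\<in>Z. f z * ?g z)"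
    using refine by (intro sum_block_mean_mult[OF fin] block_mean_cong) blast
  moreover have "(\<Sum>z\<in>Z. ?g z * ?g z) = (\<Sum>z\<in>Z. f z * ?g z)"
    by (intro sum_block_mean_mult[OF fin] block_mean_cong)
  ultimately have "(\<Sum>z\<in>Z. ?g' z * ?g z) = (\<Sum>z\<in>Z. ?g z * ?g z)" by simp
  moreover have "(\<Sum>z\<in>Z. (?g' z - ?g z)\<^sup>2)
      = (\<Sum>z\<in>Z. (?g' z)\<^sup>2) - 2 * (\<Sum>z\<in>Z. ?g' z * ?g z) + (\<Sum>z\<in>Z. ?g z * ?g z)"
    by (simp add: sum_distrib_left sum_subtractf[symmetric] sum.distrib[symmetric]
        power2_eq_square algebra_simps)
  ultimately show ?thesis by (simp add: power2_eq_square)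
qed

section \<open>Partitions into cells, irregular pairs and the energy increment\<close>

text \<open>A partition is represented by a finite family \<open>W\<close> of sets: two points are in the same cell iff
  they belong to the same members of \<open>W\<close>. Refining the partition is enlarging \<open>W\<close>.\<close>

definition trace :: "'v set set \<Rightarrow> 'v \<Rightarrow> 'v set set" where
  "trace W x = {S \<in> W. x \<in> S}"

definition trace2 :: "'v set set \<Rightarrow> 'v \<times> 'v \<Rightarrow> 'v set set \<times> 'v set set" where
  "trace2 W z = (trace W (fst z), trace W (snd z))"

definition cell :: "'v set \<Rightarrow> 'v set set \<Rightarrow> 'v set set \<Rightarrow> 'v set" where
  "cell X W a = {x \<in> X. trace W x = a}"

text \<open>One-sided irregularity: only subpairs of too small density count as witnesses.\<close>

definition irregular_witness ::
  "'v set \<Rightarrow> real \<Rightarrow> ('v \<times> 'v) set \<Rightarrow> 'v set set \<Rightarrow> 'v \<times> 'v \<Rightarrow> 'v set \<Rightarrow> 'v set \<Rightarrow> bool" where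
  "irregular_witness X \<eta> R W z A B \<longleftrightarrow>
     A \<subseteq> cell X W (trace W (fst z)) \<and> B \<subseteq> cell X W (trace W (snd z)) \<and>
     real (card A) \<ge> \<eta> * card (cell X W (trace W (fst z))) \<and>
     real (card B) \<ge> \<eta> * card (cell X W (trace W (snd z))) \<and>
     real (card (R \<inter> A \<times> B))
       < (block_mean (X \<times> X) (trace2 W) (indicator R) z - \<eta>) * (card A * card B)"

text \<open>Pairs of points are collected, not pairs of cells. Cardinality then weighs each pair of
  cells by its size, and the cells need not be of equal size.\<close>

definition irregular_pairs :: "'v set \<Rightarrow> real \<Rightarrow> ('v \<times> 'v) set \<Rightarrow> 'v set set \<Rightarrow> ('v \<times> 'v) set" where
  "irregular_pairs X \<eta> R W = {z \<in> X \<times> X. \<exists>A B. irregular_witness X \<eta> R W z A B}"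

definition energy :: "'v set \<Rightarrow> ('v \<times> 'v) set \<Rightarrow> 'v set set \<Rightarrow> real" where
  "energy X R W = (\<Sum>z\<in>X\<times>X. (block_mean (X \<times> X) (trace2 W) (indicator R) z)\<^sup>2)"

lemma trace_mono: "W \<subseteq> W' \<Longrightarrow> trace W' x = trace W' y \<Longrightarrow> trace W x = trace W y"
  by (auto simp: trace_def)

lemma trace2_mono: "W \<subseteq> W' \<Longrightarrow> trace2 W' z = trace2 W' w \<Longrightarrow> trace2 W z = trace2 W w"
  using trace_mono unfolding trace2_def by (metis prod.inject)

lemma trace2_block:
  "{w \<in> X \<times> X. trace2 W w = trace2 W z}
     = cell X W (trace W (fst z)) \<times> cell X W (trace W (snd z))"
  by (auto simp: trace2_def cell_def)

lemma irregular_witness_cong: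
  assumes "trace2 W z = trace2 W w"
  shows "irregular_witness X \<eta> R W z A B = irregular_witness X \<eta> R W w A B"
proof -
  have "trace W (fst z) = trace W (fst w)" "trace W (snd z) = trace W (snd w)"
    using assms by (auto simp: trace2_def)
  then show ?thesis
    unfolding irregular_witness_def by (simp add: block_mean_cong[of "trace2 W", OF assms])
qed

text \<open>By Pythagoras the difference of the energies is a sum of squares.\<close>

lemma energy_mono:
  assumes "finite X" "W \<subseteq> W'"
  shows "energy X R W \<le> energy X R W'"
proof -
  have "0 \<le> (\<Sum>z\<in>X\<times>X. (block_mean (X \<times> X) (trace2 W') (indicator R) z
      - block_mean (X \<times> X) (trace2 W) (indicator R) z)\<^sup>2)"
    by (intro sum_nonneg) auto
  also have "\<dots> = energy X R W' - energy X R W"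
    unfolding energy_def
    by (rule block_mean_pythagoras) (use assms trace2_mono in blast)+
  finally show ?thesis by simp
qed

lemma energy_le: "finite X \<Longrightarrow> energy X R W \<le> (card X)\<^sup>2"
proof -
  assume "finite X"
  have "energy X R W \<le> (\<Sum>z\<in>X\<times>X. 1)"
    unfolding energy_def
    by (intro sum_mono power_le_one block_mean_bounds) (auto simp: indicator_def)
  then show ?thesis by (simp add: card_cartesian_product power2_eq_square)
qed

text \<open>The local gain in density increment. The witness \<open>A \<times> B\<close> fills at
  least an \<open>\<eta>\<^sup>2\<close> fraction of the block of \<open>z\<close>, and on it the
  refined means lie on average more than \<open>\<eta>\<close> below the old one, if
  \<open>A \<times> B\<close> is nonempty; a squared shift of \<open>\<eta>\<^sup>2\<close> on that
  fraction gives the fourth power.\<close>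

lemma irregular_gain:
  assumes fin: "finite X" and sub: "W \<subseteq> W'" and \<eta>: "0 < \<eta>"
    and z: "z \<in> X \<times> X" and wit: "irregular_witness X \<eta> R W z A B" and AB: "A \<in> W'" "B \<in> W'"
  shows "\<eta>^4 \<le> block_mean (X \<times> X) (trace2 W)
     (\<lambda>w. (block_mean (X \<times> X) (trace2 W') (indicator R) w
          - block_mean (X \<times> X) (trace2 W) (indicator R) w)\<^sup>2) z"
proof -
  let ?Z = "X \<times> X"
  let ?f = "indicator R :: 'a \<times> 'a \<Rightarrow> real"
  let ?g = "block_mean ?Z (trace2 W) ?f" and ?g' = "block_mean ?Z (trace2 W') ?f"
  define CA CB where "CA = cell X W (trace W (fst z))" and "CB = cell X W (trace W (snd z))"
  note w = wit[unfolded irregular_witness_def, folded CA_def CB_def]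
  have block: "{w \<in> ?Z. trace2 W w = trace2 W z} = CA \<times> CB"
    unfolding CA_def CB_def by (rule trace2_block)
  have S: "A \<times> B \<subseteq> CA \<times> CB" using w by auto
  have CZ: "CA \<times> CB \<subseteq> ?Z" by (auto simp: CA_def CB_def cell_def)
  have finC: "finite (CA \<times> CB)" using CZ fin by (meson finite_SigmaI finite_subset)
  have finS: "finite (A \<times> B)" using S finC finite_subset by blast
  have gS: "?g w = ?g z" if "w \<in> A \<times> B" for w
    using that S block by (intro block_mean_cong) blast
  \<comment> \<open>Since \<open>A\<close> and \<open>B\<close> belong to \<open>W'\<close>, the
    rectangle is a union of refined blocks, so the refined mean integrates over it exactly like the
    indicator of \<open>R\<close>.\<close>
  have eq: "(\<Sum>w\<in>?Z. ?g' w * indicator (A \<times> B) w) = (\<Sum>w\<in>?Z. ?f w * indicator (A \<times> B) w)"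
  proof (rule sum_block_mean_mult)
    fix u v assume "trace2 W' u = trace2 W' v"
    then have "u \<in> A \<times> B \<longleftrightarrow> v \<in> A \<times> B"
      using AB by (cases u; cases v) (auto simp: trace2_def trace_def set_eq_iff)
    then show "(indicator (A \<times> B) u :: real) = indicator (A \<times> B) v"
      by (auto simp: indicator_def)
  qed (use fin in auto)
  have g': "(\<Sum>w\<in>A \<times> B. ?g' w) = card (R \<inter> A \<times> B)"
  proof -
    have SZ: "A \<times> B \<subseteq> ?Z" using S CZ by blast
    have r: "(\<Sum>w\<in>?Z. h w * indicator (A \<times> B) w) = (\<Sum>w\<in>A \<times> B. h w)" for h :: "'a \<times> 'a \<Rightarrow> real"
      by (rule sum.mono_neutral_cong_right) (use SZ fin in \<open>auto simp: indicator_def\<close>)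
    have "(\<Sum>w\<in>A \<times> B. ?g' w) = (\<Sum>w\<in>A \<times> B. ?f w)"
      using eq by (simp only: r)
    also have "\<dots> = card (R \<inter> A \<times> B)"
      using finS by (simp add: indicator_def sum.If_cases Int_commute)
    finally show ?thesis .
  qed
  have "\<eta>^4 * card (CA \<times> CB) = \<eta>\<^sup>2 * ((\<eta> * card CA) * (\<eta> * card CB))"
    by (simp add: card_cartesian_product power2_eq_square power4_eq_xxxx algebra_simps)
  also have "\<dots> \<le> \<eta>\<^sup>2 * (card A * card B)"
  proof -
    have "(\<eta> * card CA) * (\<eta> * card CB) \<le> real (card A) * real (card B)"
      using w \<eta> by (intro mult_mono) auto
    then show ?thesis by (intro mult_left_mono) auto
  qed
  \<comment> \<open>Summing \<open>t\<^sup>2 \<ge> 2 \<eta> t - \<eta>\<^sup>2\<close> over \<open>A \<times> B\<close> replaces Cauchy-Schwarz.\<close>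
  also have "\<dots> = 2 * \<eta> * (\<eta> * (card A * card B)) - \<eta>\<^sup>2 * (card A * card B)"
    by (simp add: power2_eq_square algebra_simps)
  also have "\<dots> \<le> 2 * \<eta> * (\<Sum>w\<in>A \<times> B. ?g w - ?g' w) - \<eta>\<^sup>2 * (card A * card B)"
  proof -
    have "(\<Sum>w\<in>A \<times> B. ?g w - ?g' w) = ?g z * (card A * card B) - card (R \<inter> A \<times> B)"
      using gS by (simp add: sum_subtractf g' card_cartesian_product)
    then have "\<eta> * (card A * card B) \<le> (\<Sum>w\<in>A \<times> B. ?g w - ?g' w)"
      using w by (simp add: algebra_simps)
    then show ?thesis using \<eta> by simp
  qed
  also have "\<dots> = (\<Sum>w\<in>A \<times> B. 2 * \<eta> * (?g w - ?g' w) - \<eta>\<^sup>2)"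
    unfolding sum_subtractf[of _ "\<lambda>_. \<eta>\<^sup>2"] sum_distrib_left[symmetric]
    by (simp add: card_cartesian_product)
  also have "\<dots> \<le> (\<Sum>w\<in>A \<times> B. (?g' w - ?g w)\<^sup>2)"
  proof (rule sum_mono)
    fix w
    have "0 \<le> (?g w - ?g' w - \<eta>)\<^sup>2" by simp
    then show "2 * \<eta> * (?g w - ?g' w) - \<eta>\<^sup>2 \<le> (?g' w - ?g w)\<^sup>2"
      by (simp add: power2_eq_square algebra_simps)
  qed
  also have "\<dots> \<le> (\<Sum>w\<in>CA \<times> CB. (?g' w - ?g w)\<^sup>2)"
    by (intro sum_mono2 finC S) auto
  finally have main: "\<eta>^4 * card (CA \<times> CB) \<le> (\<Sum>w\<in>CA \<times> CB. (?g' w - ?g w)\<^sup>2)" .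
  have "z \<in> CA \<times> CB" using z block by blast
  then have "card (CA \<times> CB) > 0" using finC by (metis card_gt_0_iff empty_iff)
  then show ?thesis
    using main unfolding block_mean_def[of ?Z "trace2 W" _ z] block
    by (simp only: le_divide_eq of_nat_0_less_iff if_True)
qed

text \<open>All witnesses are added at once. Each irregular pair of points then contributes
  \<open>\<eta>^4\<close>, and there are more than \<open>\<eta> * (card X)\<^sup>2\<close> of them.
  The growth of \<open>W\<close> is bounded independently of \<open>X\<close>, which keeps the final
  number of cells bounded.\<close>

lemma energy_increment:
  fixes \<eta> :: real
  assumes fin: "finite X" "finite W" and \<eta>: "0 < \<eta>"
    and bad: "card (irregular_pairs X \<eta> R W) > \<eta> * (card X)\<^sup>2"
  shows "\<exists>W'. W \<subseteq> W' \<and> finite W' \<and> card W' \<le> card W + 2 * (2 ^ card W * 2 ^ card W) \<and>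
    energy X R W' \<ge> energy X R W + \<eta>^5 * (card X)\<^sup>2"
proof -
  let ?Z = "X \<times> X"
  let ?I = "irregular_pairs X \<eta> R W"
  \<comment> \<open>Witnesses are chosen per pair of traces, not per pair of points, so there are at
    most \<open>2 ^ card W * 2 ^ card W\<close> of each kind. The choice of \<open>wB p\<close>
    refers to \<open>wA p\<close>, so that the two form one witness.\<close>
  define wA wB where
    "wA = (\<lambda>p. SOME A. \<exists>B z. z \<in> ?Z \<and> trace2 W z = p \<and> irregular_witness X \<eta> R W z A B)" and
    "wB = (\<lambda>p. SOME B. \<exists>z. z \<in> ?Z \<and> trace2 W z = p \<and> irregular_witness X \<eta> R W z (wA p) B)"
  define W' where "W' = W \<union> (wA ` (Pow W \<times> Pow W) \<union> wB ` (Pow W \<times> Pow W))"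
  have sub: "W \<subseteq> W'" by (auto simp: W'_def)
  have finW': "finite W'" using fin by (auto simp: W'_def)
  have wit: "irregular_witness X \<eta> R W z (wA (trace2 W z)) (wB (trace2 W z))" if "z \<in> ?I" for z
  proof -
    have "\<exists>A B z'. z' \<in> ?Z \<and> trace2 W z' = trace2 W z \<and> irregular_witness X \<eta> R W z' A B"
      using that by (auto simp: irregular_pairs_def)
    then have "\<exists>B z'. z' \<in> ?Z \<and> trace2 W z' = trace2 W z \<and>
        irregular_witness X \<eta> R W z' (wA (trace2 W z)) B"
      unfolding wA_def by (rule someI_ex)
    then have "\<exists>z'. z' \<in> ?Z \<and> trace2 W z' = trace2 W z \<and>
        irregular_witness X \<eta> R W z' (wA (trace2 W z)) (wB (trace2 W z))"
      unfolding wB_def by (rule someI_ex)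
    then show ?thesis using irregular_witness_cong by metis
  qed
  have inW': "wA (trace2 W z) \<in> W'" "wB (trace2 W z) \<in> W'" for z
    by (auto simp: W'_def trace2_def trace_def)
  have cW': "card W' \<le> card W + 2 * (2 ^ card W * 2 ^ card W)"
  proof -
    have c: "card (Pow W \<times> Pow W) = 2 ^ card W * 2 ^ card W"
      using fin by (simp add: card_cartesian_product card_Pow)
    have f: "finite (Pow W \<times> Pow W)" using fin by simp
    have "card W' \<le> card W + (card (wA ` (Pow W \<times> Pow W)) + card (wB ` (Pow W \<times> Pow W)))"
      unfolding W'_def by (meson add_left_mono card_Un_le order_trans)
    also have "\<dots> \<le> card W + (card (Pow W \<times> Pow W) + card (Pow W \<times> Pow W))"
      by (intro add_mono order_refl card_image_le[OF f])
    finally show ?thesis unfolding c by simp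
  qed
  let ?g = "block_mean ?Z (trace2 W) (indicator R)" and ?g' = "block_mean ?Z (trace2 W') (indicator R)"
  let ?D = "\<lambda>w. (?g' w - ?g w)\<^sup>2"
  have I: "?I \<subseteq> ?Z" by (auto simp: irregular_pairs_def)
  have finI: "finite ?I" using I fin by (meson finite_SigmaI finite_subset)
  have "\<eta>^5 * (card X)\<^sup>2 = \<eta>^4 * (\<eta> * (card X)\<^sup>2)"
    by (simp add: eval_nat_numeral)
  also have "\<dots> \<le> \<eta>^4 * card ?I"
    using bad \<eta> by (intro mult_left_mono) auto
  also have "\<dots> = (\<Sum>z\<in>?Z. \<eta>^4 * indicator ?I z)"
    using I fin by (simp add: sum_distrib_left[symmetric] indicator_def sum.If_cases Int_absorb1)
  also have "\<dots> \<le> (\<Sum>z\<in>?Z. block_mean ?Z (trace2 W) ?D z * indicator ?I z)"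
  proof (rule sum_mono)
    fix z assume "z \<in> ?Z"
    then show "\<eta>^4 * indicator ?I z \<le> block_mean ?Z (trace2 W) ?D z * indicator ?I z"
      using irregular_gain[OF fin(1) sub \<eta> _ wit inW'] by (cases "z \<in> ?I") auto
  qed
  \<comment> \<open>Irregularity depends only on the traces, so \<open>?I\<close> is a union of
    blocks and the average of \<open>?D\<close> may be replaced by \<open>?D\<close> itself.\<close>
  also have "\<dots> = (\<Sum>z\<in>?Z. ?D z * indicator ?I z)"
  proof (rule sum_block_mean_mult)
    fix z w assume "z \<in> ?Z" "w \<in> ?Z" "trace2 W z = trace2 W w"
    then have "z \<in> ?I \<longleftrightarrow> w \<in> ?I"
      unfolding irregular_pairs_def using irregular_witness_cong by blast
    then show "(indicator ?I z :: real) = indicator ?I w" by (simp add: indicator_def)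
  qed (use fin in auto)
  also have "\<dots> \<le> (\<Sum>z\<in>?Z. ?D z)"
    by (intro sum_mono) (auto simp: indicator_def)
  also have "\<dots> = energy X R W' - energy X R W"
    unfolding energy_def
    by (rule block_mean_pythagoras) (use fin sub trace2_mono in blast)+
  finally show ?thesis using sub finW' cW' by (intro exI[of _ W']) auto
qed

section \<open>Regularity\<close>

text \<open>One partition serves all relations because the potential is the sum of their energies:
  refining for one relation never lowers the energy of another. The total is at most
  \<open>s * (card X)\<^sup>2\<close>, so the number of increments is bounded in terms of
  \<open>\<eta>\<close> and \<open>s\<close>.\<close>

lemma regularity:
  fixes \<eta> :: real
  assumes \<eta>: "0 < \<eta>"
  shows "\<exists>M. \<forall>(X :: 'v set) (R :: 'i \<Rightarrow> ('v \<times> 'v) set) (I :: 'i set). finite X \<longrightarrow> finite I \<longrightarrow> card I \<le> s \<longrightarrow>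
     (\<exists>W. finite W \<and> card W \<le> M \<and> (\<forall>t\<in>I. real (card (irregular_pairs X \<eta> (R t) W)) \<le> \<eta> * (card X)\<^sup>2))"
proof -
  define step where "step = (\<lambda>w::nat. w + 2 * (2 ^ w * 2 ^ w))"
  \<comment> \<open>\<open>G j\<close> bounds the family after \<open>j\<close> refinements of the
    empty family, which is the trivial partition.\<close>
  define G where "G = (\<lambda>j. (step ^^ j) 0)"
  have step_mono: "a \<le> b \<Longrightarrow> step a \<le> step b" for a b
    unfolding step_def by (intro add_mono mult_mono power_increasing) auto
  have G_Suc: "G (Suc j) = step (G j)" for j by (simp add: G_def)
  \<comment> \<open>So many increments would push the total energy above its maximum.\<close>
  obtain J :: nat where J: "real s < J * \<eta>^5"
    using reals_Archimedean3[of "\<eta>^5"] \<eta> by auto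
  show ?thesis
  proof (intro exI[of _ "G J"] allI impI)
    fix X :: "'v set" and R :: "'i \<Rightarrow> ('v \<times> 'v) set" and I :: "'i set"
    assume fin: "finite X" "finite I" and cI: "card I \<le> s"
    let ?good = "\<lambda>W. \<forall>t\<in>I. real (card (irregular_pairs X \<eta> (R t) W)) \<le> \<eta> * (card X)\<^sup>2"
    have "\<exists>W. finite W \<and> card W \<le> G j \<and>
       (?good W \<or> (\<Sum>t\<in>I. energy X (R t) W) \<ge> j * (\<eta>^5 * (card X)\<^sup>2))" for j
    proof (induction j)
      case 0
      show ?case by (intro exI[of _ "{}"]) (auto simp: energy_def intro!: sum_nonneg)
    next
      case (Suc j)
      then obtain W where W: "finite W" "card W \<le> G j"
        "?good W \<or> (\<Sum>t\<in>I. energy X (R t) W) \<ge> j * (\<eta>^5 * (card X)\<^sup>2)" by blast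
      have Gm: "G j \<le> G (Suc j)" by (simp add: G_Suc step_def)
      show ?case
      proof (cases "?good W")
        case True
        then show ?thesis using W Gm by (intro exI[of _ W]) auto
      next
        case False
        then obtain t where t: "t \<in> I" "real (card (irregular_pairs X \<eta> (R t) W)) > \<eta> * (card X)\<^sup>2"
          by (auto simp: not_le)
        from energy_increment[OF fin(1) W(1) \<eta> t(2)] obtain W' where W':
          "W \<subseteq> W'" "finite W'" "card W' \<le> step (card W)"
          "energy X (R t) W' \<ge> energy X (R t) W + \<eta>^5 * (card X)\<^sup>2"
          unfolding step_def by blast
        have "(\<Sum>t\<in>I. energy X (R t) W) + \<eta>^5 * (card X)\<^sup>2
            = (energy X (R t) W + \<eta>^5 * (card X)\<^sup>2) + (\<Sum>t\<in>I - {t}. energy X (R t) W)"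
          using t fin by (simp add: sum.remove)
        also have "\<dots> \<le> energy X (R t) W' + (\<Sum>t\<in>I - {t}. energy X (R t) W')"
          by (intro add_mono W' sum_mono energy_mono fin)
        also have "\<dots> = (\<Sum>t\<in>I. energy X (R t) W')"
          using t fin by (simp add: sum.remove)
        finally have "(\<Sum>t\<in>I. energy X (R t) W') \<ge> Suc j * (\<eta>^5 * (card X)\<^sup>2)"
          using W(3) False by (auto simp: algebra_simps)
        moreover have "card W' \<le> G (Suc j)"
          using W'(3) step_mono[OF W(2)] by (simp add: G_Suc)
        ultimately show ?thesis using W'(2) by blast
      qed
    qed
    from this[of J] obtain W where W: "finite W" "card W \<le> G J"
      "?good W \<or> (\<Sum>t\<in>I. energy X (R t) W) \<ge> J * (\<eta>^5 * (card X)\<^sup>2)" by blast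
    have "?good W"
    \<comment> \<open>For empty \<open>X\<close> both energy bounds are 0 and give no strict
      contradiction.\<close>
    proof (cases "X = {}")
      case True
      then show ?thesis by (simp add: irregular_pairs_def)
    next
      case False
      have "(\<Sum>t\<in>I. energy X (R t) W) \<le> (\<Sum>t\<in>I. (card X)\<^sup>2)"
        unfolding of_nat_sum by (intro sum_mono energy_le fin)
      also have "\<dots> \<le> s * (card X)\<^sup>2" using cI by (simp add: mult_right_mono)
      finally have "(\<Sum>t\<in>I. energy X (R t) W) \<le> real s * (card X)\<^sup>2" by simp
      also have "\<dots> < (J * \<eta>^5) * (card X)\<^sup>2"
        using J False fin by (intro mult_strict_right_mono) (auto simp: card_gt_0_iff)
      finally show ?thesis using W(3) by (simp add: algebra_simps)
    qed
    then show "\<exists>W. finite W \<and> card W \<le> G J \<and> ?good W" using W by blast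
  qed
qed

section \<open>Dense regular cells around one surviving tuple\<close>

text \<open>Greedy embedding only needs candidate sets not to shrink too fast, so density is bounded
  from below alone.\<close>

definition lower_regular :: "real \<Rightarrow> real \<Rightarrow> ('v \<times> 'v) set \<Rightarrow> 'v set \<Rightarrow> 'v set \<Rightarrow> bool" where
  "lower_regular \<eta> d R A B \<longleftrightarrow> (\<forall>A' B'. A' \<subseteq> A \<longrightarrow> B' \<subseteq> B \<longrightarrow> \<eta> * card A \<le> card A' \<longrightarrow>
     \<eta> * card B \<le> card B' \<longrightarrow> d * (card A' * card B') \<le> card (R \<inter> A' \<times> B'))"

definition link :: "'h set \<Rightarrow> ('h \<Rightarrow> nat \<Rightarrow> 'v) \<Rightarrow> nat \<Rightarrow> nat \<Rightarrow> ('v \<times> 'v) set" where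
  "link H q i j = (\<lambda>h. (q h i, q h j)) ` H"

lemma card_small_cells:
  assumes "finite X" "finite W"
  shows "card {x \<in> X. card (cell X W (trace W x)) < L} \<le> 2 ^ card W * L"
proof -
  let ?P = "{a \<in> Pow W. card (cell X W a) < L}"
  have fin: "finite ?P" using assms by simp
  have "{x \<in> X. card (cell X W (trace W x)) < L} \<subseteq> (\<Union>a\<in>?P. cell X W a)"
    by (auto simp: cell_def trace_def)
  then have "card {x \<in> X. card (cell X W (trace W x)) < L} \<le> card (\<Union>a\<in>?P. cell X W a)"
    using assms by (intro card_mono) (auto simp: cell_def)
  also have "\<dots> \<le> (\<Sum>a\<in>?P. card (cell X W a))"
    by (rule card_UN_le[OF fin])
  also have "\<dots> \<le> (\<Sum>a\<in>?P. L)" by (intro sum_mono) auto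
  also have "\<dots> = card ?P * L" by simp
  also have "\<dots> \<le> 2 ^ card W * L"
    using card_mono[of "Pow W" ?P] assms by (auto simp: card_Pow)
  finally show ?thesis .
qed

text \<open>The sparse region is a union of blocks, so the indicator of \<open>R\<close> can be
  replaced there by its mean, which is below \<open>d\<close>.\<close>

lemma card_sparse_edges:
  fixes d :: real
  assumes fin: "finite X" and d: "0 \<le> d"
  shows "card (R \<inter> {z \<in> X \<times> X. block_mean (X \<times> X) (trace2 W) (indicator R) z < d}) \<le> d * (card X)\<^sup>2"
proof -
  let ?g = "block_mean (X \<times> X) (trace2 W) (indicator R)"
  let ?D = "{z \<in> X \<times> X. ?g z < d}"
  have "real (card (R \<inter> ?D)) = (\<Sum>z\<in>X \<times> X. indicator R z * indicator ?D z)"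
  proof -
    have "(\<Sum>z\<in>X \<times> X. indicator R z * indicator ?D z) = (\<Sum>z\<in>R \<inter> ?D. 1::real)"
      by (rule sum.mono_neutral_cong_right) (use fin in \<open>auto simp: indicator_def\<close>)
    then show ?thesis by simp
  qed
  also have "\<dots> = (\<Sum>z\<in>X \<times> X. ?g z * indicator ?D z)"
  proof (rule sum_block_mean_mult[symmetric])
    fix z w assume a: "z \<in> X \<times> X" "w \<in> X \<times> X" "trace2 W z = trace2 W w"
    have "?g z = ?g w" by (rule block_mean_cong) (rule a)
    then show "(indicator ?D z :: real) = indicator ?D w"
      using a(1,2) by (simp add: indicator_def)
  qed (use fin in auto)
  also have "\<dots> \<le> (\<Sum>z\<in>X \<times> X. d)"
    using d by (intro sum_mono) (auto simp: indicator_def)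
  also have "\<dots> = d * (card X)\<^sup>2" by (simp add: card_cartesian_product power2_eq_square)
  finally show ?thesis .
qed

text \<open>A removal argument. For each ordered pair of positions at most
  \<open>4 * d * (card X)\<^sup>2\<close> pairs of points are bad: \<open>d\<close> for irregular,
  \<open>2 * d\<close> for sparse, \<open>d\<close> for small cells. Each destroys at most
  \<open>m\<close> members of \<open>H\<close>, fewer in total than \<open>H\<close> has. The cells
  of a survivor are the ones sought.\<close>

lemma regular_tuple:
  fixes \<epsilon> d \<eta> :: real
  assumes k: "2 \<le> k" and d: "0 < d" "real (k * k * m) * (4 * d) \<le> \<epsilon>" and \<eta>: "0 < \<eta>" "\<eta> \<le> d"
  shows "\<exists>n0. \<forall>(X :: 'v set) (H :: 'h set) q. finite X \<longrightarrow> finite H \<longrightarrow> n0 \<le> card X \<longrightarrow>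
    (\<forall>h\<in>H. \<forall>i<k. q h i \<in> X) \<longrightarrow>
    (\<forall>i<k. \<forall>j<k. i \<noteq> j \<longrightarrow> (\<forall>x y. card {h \<in> H. q h i = x \<and> q h j = y} \<le> m)) \<longrightarrow>
    real (card H) > \<epsilon> * (card X)\<^sup>2 \<longrightarrow>
    (\<exists>A. (\<forall>i<k. A i \<subseteq> X \<and> L \<le> card (A i)) \<and>
      (\<forall>i<k. \<forall>j<k. i \<noteq> j \<longrightarrow> lower_regular \<eta> d (link H q i j) (A i) (A j)))"
proof -
  obtain M where M: "\<And>(X :: 'v set) (R :: nat \<times> nat \<Rightarrow> ('v \<times> 'v) set) I.
      finite X \<Longrightarrow> finite I \<Longrightarrow> card I \<le> k * k \<Longrightarrow>
      (\<exists>W. finite W \<and> card W \<le> M \<and> (\<forall>t\<in>I. real (card (irregular_pairs X \<eta> (R t) W)) \<le> \<eta> * (card X)\<^sup>2))"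
    using regularity[OF \<eta>(1), of "k * k", where ?'v = 'v and ?'i = "nat \<times> nat"] by blast
  \<comment> \<open>There are at most \<open>2 ^ M\<close> cells, so from \<open>n0\<close> points
    on, those in cells smaller than \<open>L\<close> make up at most a \<open>d\<close> fraction of
    \<open>X\<close>.\<close>
  obtain n0 :: nat where n0: "real (2 ^ M * L) < n0 * d"
    using reals_Archimedean3[OF d(1)] by blast
  show ?thesis
  proof (intro exI[of _ n0] allI impI)
    fix X :: "'v set" and H :: "'h set" and q
    assume fin: "finite X" "finite H" and n: "n0 \<le> card X"
      and qX: "\<forall>h\<in>H. \<forall>i<k. q h i \<in> X"
      and codeg: "\<forall>i<k. \<forall>j<k. i \<noteq> j \<longrightarrow> (\<forall>x y. card {h \<in> H. q h i = x \<and> q h j = y} \<le> m)"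
      and big: "real (card H) > \<epsilon> * (card X)\<^sup>2"
    define I where "I = {(i, j). i < k \<and> j < k \<and> i \<noteq> j}"
    have I_sub: "I \<subseteq> {..<k} \<times> {..<k}" by (auto simp: I_def)
    have finI: "finite I" using I_sub finite_subset by blast
    have cI: "card I \<le> k * k"
      using card_mono[OF _ I_sub] by (simp add: card_cartesian_product)
    define R where "R = (\<lambda>(i, j). link H q i j)"
    obtain W where W: "finite W" "card W \<le> M"
      "\<And>t. t \<in> I \<Longrightarrow> real (card (irregular_pairs X \<eta> (R t) W)) \<le> \<eta> * (card X)\<^sup>2"
      using M[OF fin(1) finI cI, of R] by blast
    let ?g = "\<lambda>t. block_mean (X \<times> X) (trace2 W) (indicator (R t))"
    define small where "small = {x \<in> X. card (cell X W (trace W x)) < L}"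
    \<comment> \<open>The threshold is \<open>2 * d\<close> because a regular subpair may lose
      \<open>\<eta> \<le> d\<close> of the density and must keep \<open>d\<close>.\<close>
    define sparse where "sparse = (\<lambda>t. R t \<inter> {z \<in> X \<times> X. ?g t z < 2 * d})"
    \<comment> \<open>Only the first coordinate is tested for a small cell; \<open>I\<close>
      contains both orders of every pair of positions.\<close>
    define bad where "bad = (\<lambda>t. irregular_pairs X \<eta> (R t) W \<union> (sparse t \<union> small \<times> X))"
    have bad_sub: "bad t \<subseteq> X \<times> X" for t
      by (auto simp: bad_def irregular_pairs_def sparse_def small_def)
    have fin_bad: "finite (bad t)" for t
      using bad_sub fin by (meson finite_SigmaI finite_subset)
    have card_bad: "real (card (bad t)) \<le> 4 * d * (card X)\<^sup>2" if "t \<in> I" for t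
    proof -
      have "card (bad t) \<le> card (irregular_pairs X \<eta> (R t) W) + (card (sparse t) + card (small \<times> X))"
        unfolding bad_def by (meson add_left_mono card_Un_le order_trans)
      then have "real (card (bad t)) \<le> real (card (irregular_pairs X \<eta> (R t) W))
          + (real (card (sparse t)) + real (card (small \<times> X)))"
        by (metis of_nat_add of_nat_le_iff)
      moreover have "real (card (irregular_pairs X \<eta> (R t) W)) \<le> d * (card X)\<^sup>2"
        by (rule order_trans[OF W(3)[OF that]]) (use \<eta> in \<open>intro mult_right_mono, auto\<close>)
      moreover have "real (card (sparse t)) \<le> 2 * d * (card X)\<^sup>2"
        unfolding sparse_def by (rule card_sparse_edges) (use fin d in auto)
      moreover have "real (card (small \<times> X)) \<le> d * (card X)\<^sup>2"
      proof -
        have "card small \<le> 2 ^ card W * L"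
          unfolding small_def by (rule card_small_cells[OF fin(1) W(1)])
        also have "\<dots> \<le> 2 ^ M * L" using W(2) by (intro mult_right_mono power_increasing) auto
        finally have "real (card small) \<le> real (2 ^ M * L)" by (simp only: of_nat_le_iff)
        also have "\<dots> \<le> card X * d"
          using n0 n d by (smt (verit) mult_right_mono of_nat_le_iff)
        finally have "real (card small) * card X \<le> (card X * d) * card X"
          by (intro mult_right_mono) auto
        then show ?thesis by (simp add: card_cartesian_product power2_eq_square mult_ac)
      qed
      ultimately show ?thesis by (simp add: algebra_simps)
    qed
    define B where "B = (\<lambda>t. {h \<in> H. (q h (fst t), q h (snd t)) \<in> bad t})"
    have card_B: "card (B t) \<le> card (bad t) * m" if "t \<in> I" for t
    proof -
      have "B t \<subseteq> (\<Union>z\<in>bad t. {h \<in> H. q h (fst t) = fst z \<and> q h (snd t) = snd z})"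
        by (auto simp: B_def)
      then have "card (B t) \<le> card (\<Union>z\<in>bad t. {h \<in> H. q h (fst t) = fst z \<and> q h (snd t) = snd z})"
        using fin fin_bad by (intro card_mono) auto
      also have "\<dots> \<le> (\<Sum>z\<in>bad t. card {h \<in> H. q h (fst t) = fst z \<and> q h (snd t) = snd z})"
        by (rule card_UN_le[OF fin_bad])
      also have "\<dots> \<le> (\<Sum>z\<in>bad t. m)"
        using codeg that by (intro sum_mono) (auto simp: I_def)
      finally show ?thesis by simp
    qed
    have "\<exists>h\<in>H. \<forall>t\<in>I. h \<notin> B t"
    proof (rule ccontr)
      assume "\<not> ?thesis"
      then have "H \<subseteq> (\<Union>t\<in>I. B t)" by blast
      then have "card H \<le> card (\<Union>t\<in>I. B t)"
        using finI fin by (intro card_mono) (auto simp: B_def)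
      also have "\<dots> \<le> (\<Sum>t\<in>I. card (B t))" by (rule card_UN_le[OF finI])
      also have "\<dots> \<le> (\<Sum>t\<in>I. card (bad t) * m)" using card_B by (rule sum_mono)
      finally have "real (card H) \<le> real (\<Sum>t\<in>I. card (bad t) * m)" by (simp only: of_nat_le_iff)
      also have "\<dots> = (\<Sum>t\<in>I. real (card (bad t)) * m)" by simp
      also have "\<dots> \<le> (\<Sum>t\<in>I. 4 * d * (card X)\<^sup>2 * m)"
        using card_bad by (intro sum_mono mult_right_mono) auto
      also have "\<dots> = card I * (4 * d * (card X)\<^sup>2 * m)" by simp
      also have "\<dots> \<le> real (k * k) * (4 * d * (card X)\<^sup>2 * m)"
        using cI d by (intro mult_right_mono) (simp_all only: of_nat_le_iff, simp)
      also have "\<dots> = (real (k * k * m) * (4 * d)) * (card X)\<^sup>2" by simp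
      also have "\<dots> \<le> \<epsilon> * (card X)\<^sup>2" using d by (intro mult_right_mono) auto
      finally show False using big by simp
    qed
    then obtain h where h: "h \<in> H" "\<And>t. t \<in> I \<Longrightarrow> h \<notin> B t" by blast
    define A where "A = (\<lambda>i. cell X W (trace W (q h i)))"
    show "\<exists>A. (\<forall>i<k. A i \<subseteq> X \<and> L \<le> card (A i)) \<and>
      (\<forall>i<k. \<forall>j<k. i \<noteq> j \<longrightarrow> lower_regular \<eta> d (link H q i j) (A i) (A j))"
    proof (intro exI[of _ A] conjI allI impI)
      fix i assume i: "i < k"
      show "A i \<subseteq> X" by (auto simp: A_def cell_def)
      \<comment> \<open>A second position exists since \<open>2 \<le> k\<close>; it makes
        \<open>i\<close> the first coordinate of some pair in \<open>I\<close>.\<close>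
      obtain j where j: "j < k" "j \<noteq> i"
        using k that[of 0] that[of 1] by (cases "i = 0") auto
      have "(q h i, q h j) \<notin> bad (i, j)"
        using h(1) h(2)[of "(i, j)"] i j by (auto simp: B_def I_def)
      then show "L \<le> card (A i)"
        using qX h(1) i j by (auto simp: bad_def small_def A_def not_less)
    next
      fix i j assume ij: "i < k" "j < k" "i \<noteq> j"
      let ?z = "(q h i, q h j)"
      have nb: "?z \<notin> bad (i, j)"
        using h(1) h(2)[of "(i, j)"] ij by (auto simp: B_def I_def)
      have zX: "?z \<in> X \<times> X" and zR: "?z \<in> R (i, j)"
        using qX h(1) ij by (auto simp: R_def link_def)
      have dens: "2 * d \<le> ?g (i, j) ?z"
        using nb zX zR by (auto simp: bad_def sparse_def)
      show "lower_regular \<eta> d (link H q i j) (A i) (A j)"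
        unfolding lower_regular_def
      proof (intro allI impI)
        fix A' B'
        assume *: "A' \<subseteq> A i" "B' \<subseteq> A j" "\<eta> * card (A i) \<le> card A'" "\<eta> * card (A j) \<le> card B'"
        have "\<not> irregular_witness X \<eta> (R (i, j)) W ?z A' B'"
          using nb zX by (auto simp: bad_def irregular_pairs_def)
        then have "(?g (i, j) ?z - \<eta>) * (card A' * card B') \<le> card (R (i, j) \<inter> A' \<times> B')"
          using * by (auto simp: irregular_witness_def A_def)
        moreover have "d * (card A' * card B') \<le> (?g (i, j) ?z - \<eta>) * (card A' * card B')"
          using dens \<eta> by (intro mult_right_mono) auto
        ultimately show "d * (card A' * card B') \<le> card (link H q i j \<inter> A' \<times> B')"
          by (simp add: R_def)
      qed
    qed
  qed
qed

text \<open>Otherwise the low-degree points together with \<open>D\<close> would form a large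
  subpair of density below \<open>d\<close>. The hypothesis \<open>pos\<close> makes the offending
  set nonempty, hence the inequality strict.\<close>

lemma lower_regular_few_low_degree:
  fixes \<eta> d :: real
  assumes reg: "lower_regular \<eta> d R A B" and sub: "C \<subseteq> A" "D \<subseteq> B" and fin: "finite A" "finite B"
    and big: "\<eta> * card B \<le> card D" and pos: "0 < \<eta> * card A"
  shows "card {x \<in> C. real (card {y \<in> D. (x, y) \<in> R}) < d * card D} < \<eta> * card A"
proof (rule ccontr)
  let ?L = "{x \<in> C. real (card {y \<in> D. (x, y) \<in> R}) < d * card D}"
  assume "\<not> ?thesis"
  then have ge: "\<eta> * card A \<le> card ?L" by simp
  have finL: "finite ?L" "finite D" using sub fin by (auto intro: finite_subset)
  have ne: "?L \<noteq> {}" using ge pos by (metis card.empty not_less of_nat_0)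
  have "d * (card ?L * card D) \<le> card (R \<inter> ?L \<times> D)"
    using reg[unfolded lower_regular_def, rule_format, of ?L D] ge big sub by auto
  also have "R \<inter> ?L \<times> D = (SIGMA x:?L. {y \<in> D. (x, y) \<in> R})" by auto
  also have "real (card \<dots>) = (\<Sum>x\<in>?L. real (card {y \<in> D. (x, y) \<in> R}))"
    using finL by (subst card_SigmaI) auto
  also have "\<dots> < (\<Sum>x\<in>?L. d * card D)"
    using finL ne by (intro sum_strict_mono) auto
  finally show False by (simp add: mult_ac)
qed

section \<open>Greedy embedding\<close>

text \<open>Vertices are placed one at a time while every unplaced \<open>u\<close> keeps at least a
  \<open>d ^ card S\<close> fraction of its cell as candidates. A new position must keep the
  candidates of each later neighbour, avoid used points, and avoid every member of
  \<open>\<L>\<close> through two placed points. The hypothesis \<open>size\<close> says that these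
  exclusions never exhaust the candidates.\<close>

lemma greedy_embedding:
  fixes c :: "'a \<Rightarrow> nat" and R :: "nat \<Rightarrow> nat \<Rightarrow> ('v \<times> 'v) set" and \<eta> d :: real
  assumes finV: "finite V"
    and c: "\<And>u. u \<in> V \<Longrightarrow> c u < k"
    and proper: "\<And>u w. u \<in> V \<Longrightarrow> w \<in> V \<Longrightarrow> u \<noteq> w \<Longrightarrow> {u, w} \<in> E \<Longrightarrow> c u \<noteq> c w"
    and finA: "\<And>i. i < k \<Longrightarrow> finite (A i)"
    and reg: "\<And>i j. i < k \<Longrightarrow> j < k \<Longrightarrow> i \<noteq> j \<Longrightarrow> lower_regular \<eta> d (R i j) (A i) (A j)"
    and R_sym: "\<And>i j x y. (x, y) \<in> R i j \<Longrightarrow> (y, x) \<in> R j i"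
    and lines: "\<And>x y. x \<noteq> y \<Longrightarrow> finite (\<Union>{l \<in> \<L>. x \<in> l \<and> y \<in> l}) \<and> card (\<Union>{l \<in> \<L>. x \<in> l \<and> y \<in> l}) \<le> K"
    and d: "0 < d" "d \<le> 1" and \<eta>: "0 < \<eta>" "\<eta> \<le> d ^ card V"
    and size: "\<And>i. i < k \<Longrightarrow> card V + card V * card V * K < (d ^ card V - card V * \<eta>) * card (A i)"
  shows "\<exists>\<phi>. inj_on \<phi> V \<and> (\<forall>u\<in>V. \<phi> u \<in> A (c u)) \<and>
    (\<forall>u\<in>V. \<forall>w\<in>V. u \<noteq> w \<longrightarrow> {u, w} \<in> E \<longrightarrow> (\<phi> u, \<phi> w) \<in> R (c u) (c w)) \<and>
    (\<forall>l\<in>\<L>. \<forall>u\<in>V. \<forall>v\<in>V. \<forall>w\<in>V. u \<noteq> v \<longrightarrow> v \<noteq> w \<longrightarrow> u \<noteq> w \<longrightarrow> \<not> (\<phi> u \<in> l \<and> \<phi> v \<in> l \<and> \<phi> w \<in> l))"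
proof -
  \<comment> \<open>\<open>cand \<phi> S u\<close>: positions for \<open>u\<close> compatible with the vertices of \<open>S\<close> already placed by \<open>\<phi>\<close>.\<close>
  define cand where "cand = (\<lambda>\<phi> S u. {y \<in> A (c u). \<forall>w\<in>S. {w, u} \<in> E \<longrightarrow> (\<phi> w, y) \<in> R (c w) (c u)})"
  have A_pos: "0 < card (A i)" if "i < k" for i
  proof (rule ccontr)
    assume "\<not> ?thesis"
    then have "real (card V + card V * card V * K) < 0" using size[OF that] by simp
    then show False by linarith
  qed
  let ?inv = "\<lambda>\<phi> S. inj_on \<phi> S \<and> (\<forall>u\<in>S. \<phi> u \<in> A (c u)) \<and>
    (\<forall>u\<in>S. \<forall>w\<in>S. u \<noteq> w \<longrightarrow> {u, w} \<in> E \<longrightarrow> (\<phi> u, \<phi> w) \<in> R (c u) (c w)) \<and>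
    (\<forall>l\<in>\<L>. \<forall>u\<in>S. \<forall>v\<in>S. \<forall>w\<in>S. u \<noteq> v \<longrightarrow> v \<noteq> w \<longrightarrow> u \<noteq> w \<longrightarrow> \<not> (\<phi> u \<in> l \<and> \<phi> v \<in> l \<and> \<phi> w \<in> l)) \<and>
    (\<forall>u\<in>V - S. d ^ card S * card (A (c u)) \<le> card (cand \<phi> S u))"
  have "\<exists>\<phi>. ?inv \<phi> S" if "finite S" "S \<subseteq> V" for S
    using that
  proof (induction S rule: finite_induct)
    case empty
    show ?case by (rule exI[of _ undefined]) (auto simp: cand_def)
  next
    case (insert v S)
    then obtain \<phi> where inv: "?inv \<phi> S" by auto
    have inj\<phi>: "inj_on \<phi> S" using inv by (rule conjunct1)
    have \<phi>A: "\<And>u. u \<in> S \<Longrightarrow> \<phi> u \<in> A (c u)" using inv by blast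
    have \<phi>R: "\<And>u w. u \<in> S \<Longrightarrow> w \<in> S \<Longrightarrow> u \<noteq> w \<Longrightarrow> {u, w} \<in> E \<Longrightarrow> (\<phi> u, \<phi> w) \<in> R (c u) (c w)"
      using inv by blast
    have vV: "v \<in> V" and SV: "S \<subseteq> V" using insert.prems by auto
    have cS: "card S \<le> card V" using SV finV card_mono by blast
    have dS: "d ^ card V \<le> d ^ card S" using d cS by (intro power_decreasing) auto
    define Cv where "Cv = cand \<phi> S v"
    define N where "N = {u \<in> V - insert v S. {v, u} \<in> E}"
    \<comment> \<open>Positions for \<open>v\<close> that would cut the candidates of
      \<open>u\<close> by more than the factor \<open>d\<close>.\<close>
    define low where "low = (\<lambda>u. {x \<in> Cv. real (card {y \<in> cand \<phi> S u. (x, y) \<in> R (c v) (c u)})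
        < d * card (cand \<phi> S u)})"
    \<comment> \<open>Used points are excluded explicitly: vertices of one colour share a cell, and
      the cells of different colours may overlap.\<close>
    define forb where "forb = \<phi> ` S \<union> (\<Union>(u, w)\<in>{(u, w). u \<in> S \<and> w \<in> S \<and> u \<noteq> w}.
        \<Union>{l \<in> \<L>. \<phi> u \<in> l \<and> \<phi> w \<in> l})"
    have cand_sub: "cand \<phi> S u \<subseteq> A (c u)" for u by (auto simp: cand_def)
    have cand_big: "d ^ card V * card (A (c u)) \<le> card (cand \<phi> S u)" if "u \<in> V - S" for u
    proof -
      have "d ^ card V * card (A (c u)) \<le> d ^ card S * card (A (c u))"
        using dS by (intro mult_right_mono) auto
      also have "\<dots> \<le> card (cand \<phi> S u)" using inv that by auto
      finally show ?thesis .
    qed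
    have finN: "finite N" "card N \<le> card V"
      using finV by (auto simp: N_def intro!: card_mono)
    have low: "real (card (low u)) < \<eta> * card (A (c v))" if u: "u \<in> N" for u
      unfolding low_def
    proof (rule lower_regular_few_low_degree)
      show "lower_regular \<eta> d (R (c v) (c u)) (A (c v)) (A (c u))"
        using u vV by (intro reg c proper) (auto simp: N_def)
      show "Cv \<subseteq> A (c v)" "cand \<phi> S u \<subseteq> A (c u)" using cand_sub by (auto simp: Cv_def)
      show "finite (A (c v))" "finite (A (c u))" using u vV finA c by (auto simp: N_def)
      \<comment> \<open>The bound \<open>\<eta> \<le> d ^ card V\<close> keeps candidate sets large
        enough for regularity to apply until the last step.\<close>
      have "\<eta> * card (A (c u)) \<le> d ^ card V * card (A (c u))"
        using \<eta> by (intro mult_right_mono) auto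
      also have "\<dots> \<le> card (cand \<phi> S u)" using u by (intro cand_big) (auto simp: N_def)
      finally show "\<eta> * card (A (c u)) \<le> card (cand \<phi> S u)" .
      show "0 < \<eta> * card (A (c v))" using \<eta> A_pos[OF c[OF vV]] by simp
    qed
    have finS2: "finite {(u, w). u \<in> S \<and> w \<in> S \<and> u \<noteq> w}"
      by (rule finite_subset[of _ "S \<times> S"]) (use insert.hyps in auto)
    have S2: "card {(u, w). u \<in> S \<and> w \<in> S \<and> u \<noteq> w} \<le> card V * card V"
    proof -
      have "card {(u, w). u \<in> S \<and> w \<in> S \<and> u \<noteq> w} \<le> card (V \<times> V)"
        using finV SV by (intro card_mono) auto
      then show ?thesis by (simp add: card_cartesian_product)
    qed
    have ne: "\<phi> u \<noteq> \<phi> w" if "u \<in> S" "w \<in> S" "u \<noteq> w" for u w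
      using inj_onD[OF inj\<phi>, of u w] that by blast
    have fin_forb: "finite forb"
      unfolding forb_def using finS2 insert.hyps lines ne by (intro finite_UnI finite_UN_I) auto
    have card_forb: "card forb \<le> card V + card V * card V * K"
    proof -
      have "card forb \<le> card (\<phi> ` S) + card (\<Union>(u, w)\<in>{(u, w). u \<in> S \<and> w \<in> S \<and> u \<noteq> w}.
          \<Union>{l \<in> \<L>. \<phi> u \<in> l \<and> \<phi> w \<in> l})"
        unfolding forb_def by (rule card_Un_le)
      also have "card (\<phi> ` S) \<le> card V" using cS card_image_le[OF insert.hyps(1)] order_trans by blast
      also have "card (\<Union>(u, w)\<in>{(u, w). u \<in> S \<and> w \<in> S \<and> u \<noteq> w}. \<Union>{l \<in> \<L>. \<phi> u \<in> l \<and> \<phi> w \<in> l})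
          \<le> (\<Sum>(u, w)\<in>{(u, w). u \<in> S \<and> w \<in> S \<and> u \<noteq> w}. card (\<Union>{l \<in> \<L>. \<phi> u \<in> l \<and> \<phi> w \<in> l}))"
        using card_UN_le[OF finS2, of "\<lambda>(u, w). \<Union>{l \<in> \<L>. \<phi> u \<in> l \<and> \<phi> w \<in> l}"]
        by (simp add: case_prod_unfold)
      also have "\<dots> \<le> (\<Sum>(u, w)\<in>{(u, w). u \<in> S \<and> w \<in> S \<and> u \<noteq> w}. K)"
        using lines ne by (intro sum_mono) auto
      also have "\<dots> = card {(u, w). u \<in> S \<and> w \<in> S \<and> u \<noteq> w} * K" by (simp add: case_prod_unfold)
      also have "\<dots> \<le> card V * card V * K" using S2 by (rule mult_le_mono1)
      finally show ?thesis by simp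
    qed
    have "real (card ((\<Union>u\<in>N. low u) \<union> forb)) < card Cv"
    proof -
      have "card ((\<Union>u\<in>N. low u) \<union> forb) \<le> (\<Sum>u\<in>N. card (low u)) + card forb"
        using card_Un_le[of "\<Union>u\<in>N. low u" forb] card_UN_le[OF finN(1), of low] by linarith
      then have "real (card ((\<Union>u\<in>N. low u) \<union> forb)) \<le> real ((\<Sum>u\<in>N. card (low u)) + card forb)"
        by (simp only: of_nat_le_iff)
      also have "\<dots> = (\<Sum>u\<in>N. real (card (low u))) + card forb" by simp
      also have "\<dots> \<le> (\<Sum>u\<in>N. \<eta> * card (A (c v))) + (card V + card V * card V * K)"
        using low card_forb by (intro add_mono sum_mono) (auto simp only: of_nat_le_iff intro: less_imp_le)
      also have "(\<Sum>u\<in>N. \<eta> * card (A (c v))) \<le> card V * (\<eta> * card (A (c v)))"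
        using finN \<eta> by (simp add: mult_right_mono)
      also have "card V * (\<eta> * card (A (c v))) + (card V + card V * card V * K)
          < d ^ card V * card (A (c v))"
        using size[OF c[OF vV]] by (simp add: algebra_simps)
      also have "\<dots> \<le> card Cv"
        unfolding Cv_def using vV insert.hyps by (intro cand_big) auto
      finally show ?thesis by simp
    qed
    moreover have "finite ((\<Union>u\<in>N. low u) \<union> forb)"
    proof -
      have "finite Cv" using finA[OF c[OF vV]] cand_sub finite_subset unfolding Cv_def by blast
      then show ?thesis using finN fin_forb by (auto simp: low_def)
    qed
    ultimately have "\<not> Cv \<subseteq> (\<Union>u\<in>N. low u) \<union> forb"
      using card_mono[of "(\<Union>u\<in>N. low u) \<union> forb" Cv] by linarith
    then obtain x where x: "x \<in> Cv" "\<And>u. u \<in> N \<Longrightarrow> x \<notin> low u" "x \<notin> forb"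
      by blast
    define \<psi> where "\<psi> = \<phi>(v := x)"
    have \<psi>v: "\<psi> v = x" and \<psi>S: "\<And>u. u \<in> S \<Longrightarrow> \<psi> u = \<phi> u"
      using insert.hyps by (auto simp: \<psi>_def)
    have xA: "x \<in> A (c v)" and xR: "\<And>w. w \<in> S \<Longrightarrow> {w, v} \<in> E \<Longrightarrow> (\<phi> w, x) \<in> R (c w) (c v)"
      using x(1) by (auto simp: Cv_def cand_def)
    have xl: "\<not> (\<phi> u \<in> l \<and> \<phi> w \<in> l \<and> x \<in> l)" if "l \<in> \<L>" "u \<in> S" "w \<in> S" "u \<noteq> w" for l u w
      using x(3) that by (auto simp: forb_def)
    have "inj_on \<psi> (insert v S)"
    proof -
      have "inj_on \<psi> S" using inj\<phi> \<psi>S by (simp cong: inj_on_cong)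
      moreover have "\<psi> v \<notin> \<psi> ` S" using x(3) \<psi>v \<psi>S by (auto simp: forb_def)
      ultimately show ?thesis using insert.hyps by simp
    qed
    moreover have "\<forall>u\<in>insert v S. \<psi> u \<in> A (c u)"
      using \<phi>A xA \<psi>v \<psi>S by auto
    moreover have "\<forall>u\<in>insert v S. \<forall>w\<in>insert v S. u \<noteq> w \<longrightarrow> {u, w} \<in> E \<longrightarrow> (\<psi> u, \<psi> w) \<in> R (c u) (c w)"
    proof (intro ballI impI)
      fix u w assume uw: "u \<in> insert v S" "w \<in> insert v S" "u \<noteq> w" "{u, w} \<in> E"
      then consider "u \<in> S" "w \<in> S" | "u = v" "w \<in> S" | "u \<in> S" "w = v" by auto
      then show "(\<psi> u, \<psi> w) \<in> R (c u) (c w)"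
      proof cases
        case 1 then show ?thesis using \<phi>R[of u w] uw \<psi>S by simp
      next
        \<comment> \<open>Candidates record pairs from the placed vertex to the new one; the reverse
          order needs \<open>R_sym\<close>.\<close>
        case 2 then show ?thesis using R_sym[OF xR[of w]] uw \<psi>S \<psi>v by (simp add: insert_commute)
      next
        case 3 then show ?thesis using xR[of u] uw \<psi>S \<psi>v by simp
      qed
    qed
    moreover have "\<forall>l\<in>\<L>. \<forall>u\<in>insert v S. \<forall>t\<in>insert v S. \<forall>w\<in>insert v S.
        u \<noteq> t \<longrightarrow> t \<noteq> w \<longrightarrow> u \<noteq> w \<longrightarrow> \<not> (\<psi> u \<in> l \<and> \<psi> t \<in> l \<and> \<psi> w \<in> l)"
    proof (intro ballI impI)
      fix l u t w
      assume *: "l \<in> \<L>" "u \<in> insert v S" "t \<in> insert v S" "w \<in> insert v S" "u \<noteq> t" "t \<noteq> w" "u \<noteq> w"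
      then consider "u \<in> S" "t \<in> S" "w \<in> S" | "u = v" "t \<in> S" "w \<in> S" | "u \<in> S" "t = v" "w \<in> S"
        | "u \<in> S" "t \<in> S" "w = v" by auto
      then show "\<not> (\<psi> u \<in> l \<and> \<psi> t \<in> l \<and> \<psi> w \<in> l)"
      proof cases
        case 1
        have "\<not> (\<phi> u \<in> l \<and> \<phi> t \<in> l \<and> \<phi> w \<in> l)" using inv 1 * by blast
        then show ?thesis using 1 \<psi>S by simp
      next
        case 2 then show ?thesis using xl[of l t w] * \<psi>S[of t] \<psi>S[of w] \<psi>v by auto
      next
        case 3 then show ?thesis using xl[of l u w] * \<psi>S[of u] \<psi>S[of w] \<psi>v by auto
      next
        case 4 then show ?thesis using xl[of l u t] * \<psi>S[of u] \<psi>S[of t] \<psi>v by auto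
      qed
    qed
    moreover have "\<forall>u\<in>V - insert v S. d ^ card (insert v S) * card (A (c u)) \<le> card (cand \<psi> (insert v S) u)"
    proof
      fix u assume u: "u \<in> V - insert v S"
      have old: "d ^ card S * card (A (c u)) \<le> card (cand \<phi> S u)" using inv u by blast
      have cs: "d ^ card (insert v S) = d * d ^ card S" using insert.hyps by simp
      have cu: "cand \<psi> (insert v S) u
          = {y \<in> cand \<phi> S u. {v, u} \<in> E \<longrightarrow> (x, y) \<in> R (c v) (c u)}"
        using \<psi>S \<psi>v by (auto simp: cand_def)
      have low': "d * (d ^ card S * card (A (c u))) \<le> d * card (cand \<phi> S u)"
        using old d by (intro mult_left_mono) auto
      show "d ^ card (insert v S) * card (A (c u)) \<le> card (cand \<psi> (insert v S) u)"
      proof (cases "{v, u} \<in> E")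
        case True
        then have "u \<in> N" using u by (auto simp: N_def)
        then have "d * card (cand \<phi> S u) \<le> card {y \<in> cand \<phi> S u. (x, y) \<in> R (c v) (c u)}"
          using x(1) x(2)[of u] by (auto simp: low_def not_less)
        then show ?thesis using low' True by (simp add: cs cu mult.assoc)
      next
        case False
        \<comment> \<open>Without an edge no candidate is lost, and the weaker bound follows from
          \<open>d \<le> 1\<close>.\<close>
        have "d * card (cand \<phi> S u) \<le> 1 * real (card (cand \<phi> S u))" using d by (intro mult_right_mono) auto
        then show ?thesis using low' False by (simp add: cs cu mult.assoc)
      qed
    qed
    ultimately show ?case by (intro exI[of _ \<psi>] conjI)
  qed
  from this[OF finV subset_refl] show ?thesis by (elim exE conjE) (intro exI conjI)
qed

section \<open>Berge copies\<close>

text \<open>The \<open>LEAST\<close> is informative only if some \<open>N\<close> works. Ramsey's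
  theorem for a red clique on \<open>card VG\<close> vertices supplies one, as any bijection embeds
  \<open>VG\<close> into such a clique.\<close>

lemma ramsey_number_property:
  assumes "graph VG EG"
  shows "coloured_copy (ramsey_number {0..<k} (complete_graph_edges k) VG EG) col False
           {0..<k} (complete_graph_edges k)
       \<or> coloured_copy (ramsey_number {0..<k} (complete_graph_edges k) VG EG) col True VG EG"
proof -
  have finV: "finite VG" and EG: "\<And>e. e \<in> EG \<Longrightarrow> e \<subseteq> VG \<and> card e = 2"
    using assms by (auto simp: graph_def)
  obtain N :: nat where N: "\<And>(X :: nat set) F. finite X \<Longrightarrow> N \<le> card X \<Longrightarrow>
      \<exists>S\<subseteq>X. card S = card VG \<and> clique S F \<or> card S = k \<and> indep S F"
    using ramsey2[of "card VG" k] by metis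
  have "coloured_copy N col False {0..<k} (complete_graph_edges k) \<or> coloured_copy N col True VG EG"
    for col
  proof -
    obtain S where S: "S \<subseteq> {0..<N}"
      "card S = card VG \<and> clique S {e. col e} \<or> card S = k \<and> indep S {e. col e}"
      using N[of "{0..<N}" "{e. col e}"] by auto
    have finS: "finite S" using S(1) finite_subset by blast
    from S(2) show ?thesis
    proof
      assume a: "card S = card VG \<and> clique S {e. col e}"
      then obtain \<phi> where \<phi>: "bij_betw \<phi> VG S"
        using finV finS by (metis finite_same_card_bij)
      have "col (\<phi> ` e)" if e: "e \<in> EG" for e
      proof -
        obtain u w where uw: "e = {u, w}" "u \<noteq> w" using EG[OF e] by (meson card_2_iff)
        then have "u \<in> VG" "w \<in> VG" using EG[OF e] by auto
        then have "\<phi> u \<in> S" "\<phi> w \<in> S" "\<phi> u \<noteq> \<phi> w"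
          using \<phi> uw by (auto simp: bij_betw_def inj_on_def)
        then show ?thesis using a uw by (auto simp: clique_def)
      qed
      then have "coloured_copy N col True VG EG"
        unfolding coloured_copy_def using \<phi> S(1) by (intro exI[of _ \<phi>]) (auto simp: bij_betw_def)
      then show ?thesis ..
    next
      assume a: "card S = k \<and> indep S {e. col e}"
      then obtain \<phi> where \<phi>: "bij_betw \<phi> {0..<k} S"
        using finS ex_bij_betw_nat_finite by blast
      have "\<not> col (\<phi> ` e)" if e: "e \<in> complete_graph_edges k" for e
      proof -
        obtain u w where uw: "e = {u, w}" "u \<noteq> w" "u \<in> {0..<k}" "w \<in> {0..<k}"
          using e unfolding complete_graph_edges_def by (auto simp: card_2_iff)
        then have "\<phi> u \<in> S" "\<phi> w \<in> S" "\<phi> u \<noteq> \<phi> w"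
          using \<phi> by (auto simp: bij_betw_def inj_on_def)
        then show ?thesis using a uw by (auto simp: indep_def)
      qed
      then have "coloured_copy N col False {0..<k} (complete_graph_edges k)"
        unfolding coloured_copy_def using \<phi> S(1) by (intro exI[of _ \<phi>]) (auto simp: bij_betw_def)
      then show ?thesis ..
    qed
  qed
  then have "\<exists>N. \<forall>col. coloured_copy N col False {0..<k} (complete_graph_edges k) \<or> coloured_copy N col True VG EG"
    by blast
  then show ?thesis unfolding ramsey_number_def by (rule LeastI2_ex) blast
qed

text \<open>An injective colouring of \<open>V\<close> shows that the minimum is attained.\<close>

lemma chromatic_number_colouring:
  assumes "graph V E"
  obtains c where "c ` V \<subseteq> {0..<chromatic_number V E}"
    "\<And>e u v. e \<in> E \<Longrightarrow> u \<in> e \<Longrightarrow> v \<in> e \<Longrightarrow> u \<noteq> v \<Longrightarrow> c u \<noteq> c v"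
proof -
  let ?P = "\<lambda>k. \<exists>c. c ` V \<subseteq> {0..<k} \<and> (\<forall>e\<in>E. \<forall>u\<in>e. \<forall>v\<in>e. u \<noteq> v \<longrightarrow> c u \<noteq> c v)"
  have "finite V" and EV: "\<And>e. e \<in> E \<Longrightarrow> e \<subseteq> V" using assms by (auto simp: graph_def)
  then obtain c where c: "bij_betw c V {0..<card V}" using ex_bij_betw_finite_nat by blast
  have "?P (card V)"
    using c EV by (intro exI[of _ c]) (auto simp: bij_betw_def inj_on_def subset_iff)
  then have "?P (chromatic_number V E)"
    unfolding chromatic_number_def by (rule LeastI)
  then obtain c where c: "c ` V \<subseteq> {0..<chromatic_number V E}"
    "\<forall>e\<in>E. \<forall>u\<in>e. \<forall>v\<in>e. u \<noteq> v \<longrightarrow> c u \<noteq> c v" by (elim exE conjE)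
  show ?thesis by (rule that[OF c(1)]) (use c(2) in blast)
qed

section \<open>Choosing distinct hyperedges for the edges of the core\<close>

text \<open>Every set is at least as large as the number of indices, so a greedy choice never gets
  stuck.\<close>

lemma distinct_representatives:
  assumes "finite S" "card S \<le> n" "\<And>e. e \<in> S \<Longrightarrow> n \<le> card (A e)"
  shows "\<exists>f. inj_on f S \<and> (\<forall>e\<in>S. f e \<in> A e)"
  using assms
proof (induction S rule: finite_induct)
  case empty
  show ?case by simp
next
  case (insert e S)
  then obtain f where f: "inj_on f S" "\<forall>e\<in>S. f e \<in> A e" by fastforce
  have "card (f ` S) < card (A e)"
    using insert.prems(1) insert.prems(2)[of e] insert.hyps card_image[OF f(1)] by simp
  then have "\<not> A e \<subseteq> f ` S" using insert.hyps card_mono[of "f ` S" "A e"] by auto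
  then obtain y where y: "y \<in> A e" "y \<notin> f ` S" by blast
  have "inj_on (f(e := y)) (insert e S)"
    using f y insert.hyps by (auto simp: inj_on_def)
  moreover have "\<forall>a\<in>insert e S. (f(e := y)) a \<in> A a" using f y by auto
  ultimately show ?case by blast
qed

lemma finite_graph_edges: "graph V E \<Longrightarrow> finite E"
  by (rule finite_subset[of _ "Pow V"]) (auto simp: graph_def)

text \<open>The hyperedge \<open>h\<close> contains all of the embedded \<open>V\<close>, so it can
  serve \<open>e\<close>. The other \<open>card E - 1\<close> edges each retain at least that many
  hyperedges after \<open>h\<close> is set aside.\<close>

lemma contains_berge_of_high_codegree:
  assumes g: "graph V E" and e: "e \<in> E" and h: "h \<in> H" "h \<subseteq> {0..<n}"
    and \<psi>: "inj_on \<psi> V" "\<psi> ` V \<subseteq> h"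
    and codeg: "\<And>a. a \<in> E - {e} \<Longrightarrow> card E \<le> card {h' \<in> H. \<psi> ` a \<subseteq> h'}"
  shows "contains_berge V E n H"
proof -
  have finE: "finite E" using g by (rule finite_graph_edges)
  have "\<exists>f. inj_on f (E - {e}) \<and> (\<forall>a\<in>E - {e}. f a \<in> {h' \<in> H. \<psi> ` a \<subseteq> h'} - {h})"
  proof (rule distinct_representatives)
    fix a assume "a \<in> E - {e}"
    then have "card E - 1 \<le> card {h' \<in> H. \<psi> ` a \<subseteq> h'} - 1" using codeg by (simp add: diff_le_mono)
    also have "\<dots> \<le> card ({h' \<in> H. \<psi> ` a \<subseteq> h'} - {h})"
      using diff_card_le_card_Diff[of "{h}"] by simp
    finally show "card E - 1 \<le> card ({h' \<in> H. \<psi> ` a \<subseteq> h'} - {h})" .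
  qed (use finE e in auto)
  then obtain f where f: "inj_on f (E - {e})" "\<And>a. a \<in> E - {e} \<Longrightarrow> f a \<in> H \<and> \<psi> ` a \<subseteq> f a \<and> f a \<noteq> h"
    by auto
  have eV: "e \<subseteq> V" using g e by (auto simp: graph_def)
  let ?f = "f(e := h)"
  have "inj_on ?f E"
  proof (rule inj_onI)
    fix a b assume ab: "a \<in> E" "b \<in> E" "?f a = ?f b"
    show "a = b"
      using ab f(2)[of a] f(2)[of b] inj_onD[OF f(1), of a b] by (auto split: if_splits)
  qed
  moreover have "?f ` E \<subseteq> H" using f(2) h(1) by auto
  moreover have "\<forall>a\<in>E. \<psi> ` a \<subseteq> ?f a"
  proof
    fix a assume "a \<in> E"
    then show "\<psi> ` a \<subseteq> ?f a" using f(2)[of a] \<psi>(2) eV by (cases "a = e") auto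
  qed
  ultimately show ?thesis
    unfolding contains_berge_def using \<psi> h(2) by (intro exI[of _ \<psi>] exI[of _ ?f]) auto
qed

text \<open>Ramsey's property is applied inside \<open>h\<close> to the colouring by codegree. A red
  copy of the graph without \<open>e\<close> would yield a Berge copy with \<open>h\<close> in the
  role of \<open>e\<close>, so the blue clique must occur.\<close>

lemma low_codegree_clique:
  assumes g: "graph V E" and e: "e \<in> E" and h: "h \<in> H" "h \<subseteq> {0..<n}" "finite h"
    and r: "ramsey_number {0..<k} (complete_graph_edges k) V (E - {e}) \<le> card h"
    and free: "\<not> contains_berge V E n H"
  shows "\<exists>q. inj_on q {..<k} \<and> q ` {..<k} \<subseteq> h \<and>
    (\<forall>i<k. \<forall>j<k. i \<noteq> j \<longrightarrow> card {h' \<in> H. q i \<in> h' \<and> q j \<in> h'} < card E)"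
proof -
  let ?N = "ramsey_number {0..<k} (complete_graph_edges k) V (E - {e})"
  obtain \<iota> where \<iota>: "bij_betw \<iota> {0..<card h} h" using ex_bij_betw_nat_finite h(3) by blast
  have inj: "inj_on \<iota> {0..<?N}" and img: "\<iota> ` {0..<?N} \<subseteq> h"
    using \<iota> r by (auto simp: bij_betw_def intro: inj_on_subset)
  \<comment> \<open>The colouring of pairs in \<open>h\<close> is pulled back along
    \<open>\<iota>\<close>, whose first \<open>?N\<close> values lie in \<open>h\<close> because
    \<open>?N \<le> card h\<close>.\<close>
  define col where "col = (\<lambda>s. card E \<le> card {h' \<in> H. \<iota> ` s \<subseteq> h'})"
  have g': "graph V (E - {e})" using g by (auto simp: graph_def)
  from ramsey_number_property[OF g', of k col] show ?thesis
  proof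
    assume "coloured_copy ?N col False {0..<k} (complete_graph_edges k)"
    then obtain \<phi> where \<phi>: "inj_on \<phi> {0..<k}" "\<phi> ` {0..<k} \<subseteq> {0..<?N}"
      "\<forall>s\<in>complete_graph_edges k. \<not> col (\<phi> ` s)"
      by (auto simp: coloured_copy_def)
    show ?thesis
    proof (intro exI[of _ "\<iota> \<circ> \<phi>"] conjI allI impI)
      show "inj_on (\<iota> \<circ> \<phi>) {..<k}"
        using \<phi> inj by (auto simp: lessThan_atLeast0 intro!: comp_inj_on intro: inj_on_subset)
      show "(\<iota> \<circ> \<phi>) ` {..<k} \<subseteq> h"
        using \<phi>(2) img by (auto simp: lessThan_atLeast0 image_subset_iff)
      fix i j assume ij: "i < k" "j < k" "i \<noteq> j"
      then have "{i, j} \<in> complete_graph_edges k" by (auto simp: complete_graph_edges_def)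
      then have "\<not> col (\<phi> ` {i, j})" using \<phi>(3) by blast
      then show "card {h' \<in> H. (\<iota> \<circ> \<phi>) i \<in> h' \<and> (\<iota> \<circ> \<phi>) j \<in> h'} < card E"
        by (simp add: col_def)
    qed
  next
    assume "coloured_copy ?N col True V (E - {e})"
    then obtain \<phi> where \<phi>: "inj_on \<phi> V" "\<phi> ` V \<subseteq> {0..<?N}" "\<forall>s\<in>E - {e}. col (\<phi> ` s)"
      by (auto simp: coloured_copy_def)
    have "contains_berge V E n H"
    proof (rule contains_berge_of_high_codegree[OF g e h(1,2), of "\<iota> \<circ> \<phi>"])
      show "inj_on (\<iota> \<circ> \<phi>) V"
        using \<phi> inj by (auto intro!: comp_inj_on intro: inj_on_subset)
      show "(\<iota> \<circ> \<phi>) ` V \<subseteq> h" using \<phi>(2) img by (auto simp: image_subset_iff)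
      show "card E \<le> card {h' \<in> H. (\<iota> \<circ> \<phi>) ` a \<subseteq> h'}" if "a \<in> E - {e}" for a
        using bspec[OF \<phi>(3) that] by (simp add: col_def image_image)
    qed
    then show ?thesis using free by simp
  qed
qed

text \<open>Two distinct edges span at least three vertices, so one hyperedge chosen for both would
  have three embedded vertices in its \<open>L h\<close>. Only the chosen subset \<open>L h\<close>,
  not all of \<open>h\<close>, has to avoid this.\<close>

lemma contains_berge_of_embedding:
  assumes g: "graph V E"
    and \<phi>: "inj_on \<phi> V" "\<phi> ` V \<subseteq> {0..<n}"
    and qh: "\<And>h. h \<in> H \<Longrightarrow> L h \<subseteq> h"
    and edge: "\<And>u w. u \<in> V \<Longrightarrow> w \<in> V \<Longrightarrow> u \<noteq> w \<Longrightarrow> {u, w} \<in> E \<Longrightarrow> \<exists>h\<in>H. \<phi> u \<in> L h \<and> \<phi> w \<in> L h"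
    and three: "\<And>h u v w. h \<in> H \<Longrightarrow> u \<in> V \<Longrightarrow> v \<in> V \<Longrightarrow> w \<in> V \<Longrightarrow> u \<noteq> v \<Longrightarrow> v \<noteq> w \<Longrightarrow> u \<noteq> w \<Longrightarrow>
        \<not> (\<phi> u \<in> L h \<and> \<phi> v \<in> L h \<and> \<phi> w \<in> L h)"
  shows "contains_berge V E n H"
proof -
  have two: "\<exists>u w. a = {u, w} \<and> u \<noteq> w \<and> u \<in> V \<and> w \<in> V" if "a \<in> E" for a
    using g that unfolding graph_def by (metis card_2_iff insert_subset)
  have "\<forall>a\<in>E. \<exists>h. h \<in> H \<and> \<phi> ` a \<subseteq> L h"
  proof
    fix a assume a: "a \<in> E"
    then obtain u w where "a = {u, w}" "u \<noteq> w" "u \<in> V" "w \<in> V" using two by blast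
    then show "\<exists>h. h \<in> H \<and> \<phi> ` a \<subseteq> L h" using edge[of u w] a by auto
  qed
  then obtain f where f: "\<And>a. a \<in> E \<Longrightarrow> f a \<in> H \<and> \<phi> ` a \<subseteq> L (f a)" by metis
  have "inj_on f E"
  proof (rule inj_onI, rule ccontr)
    fix a b assume ab: "a \<in> E" "b \<in> E" "f a = f b" "a \<noteq> b"
    obtain u w where uw: "a = {u, w}" "u \<noteq> w" "u \<in> V" "w \<in> V" using two ab(1) by blast
    obtain s t where st: "b = {s, t}" "s \<noteq> t" "s \<in> V" "t \<in> V" using two ab(2) by blast
    obtain x where x: "x \<in> b" "x \<noteq> u" "x \<noteq> w" using uw st ab(4) by blast
    have "\<phi> u \<in> L (f a) \<and> \<phi> w \<in> L (f a) \<and> \<phi> x \<in> L (f a)"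
      using f[OF ab(1)] f[OF ab(2)] ab(3) uw x by auto
    then show False using three[of "f a" u w x] f[OF ab(1)] uw st x by auto
  qed
  moreover have "f ` E \<subseteq> H" using f by blast
  moreover have "\<forall>a\<in>E. \<phi> ` a \<subseteq> f a" using f qh by blast
  ultimately show ?thesis unfolding contains_berge_def using \<phi> by blast
qed

section \<open>The quadratic density bound for Berge-free hypergraphs\<close>

text \<open>The constants \<open>d\<close>, \<open>\<eta>\<close>, \<open>L\<close> and
  \<open>n0\<close> are fixed in this order, before \<open>n\<close> and \<open>H\<close>. A denser
  Berge-free \<open>H\<close> would have cliques in all its hyperedges, hence regular cells, an
  embedding along a proper colouring, and a Berge copy.\<close>

lemma berge_free_sparse:
  fixes \<epsilon> :: real
  assumes g: "graph V E" and e: "e \<in> E" and \<epsilon>: "0 < \<epsilon>"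
    and r: "ramsey_number {0..<chromatic_number V E} (complete_graph_edges (chromatic_number V E))
              V (E - {e}) \<le> r"
  shows "\<exists>n0. \<forall>n\<ge>n0. \<forall>H. uniform_hypergraph r n H \<longrightarrow> \<not> contains_berge V E n H \<longrightarrow>
    real (card H) \<le> \<epsilon> * (real n)\<^sup>2"
proof -
  define k where "k = chromatic_number V E"
  define m where "m = card E"
  define v where "v = card V"
  obtain c where c: "c ` V \<subseteq> {0..<k}"
    and proper: "\<And>a u v. a \<in> E \<Longrightarrow> u \<in> a \<Longrightarrow> v \<in> a \<Longrightarrow> u \<noteq> v \<Longrightarrow> c u \<noteq> c v"
    using chromatic_number_colouring[OF g] unfolding k_def by metis
  have finV: "finite V" and finE: "finite E" using g finite_graph_edges by (auto simp: graph_def)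
  obtain a b where ab: "e = {a, b}" "a \<noteq> b" "a \<in> V" "b \<in> V"
    using g e unfolding graph_def by (metis card_2_iff insert_subset)
  have k: "2 \<le> k"
  proof -
    have "c a < k" "c b < k" "c a \<noteq> c b" using c ab e proper[of e a b] by auto
    then show ?thesis by linarith
  qed
  have m: "0 < m" using finE e by (auto simp: m_def card_gt_0_iff)
  have v: "0 < v" using finV ab by (auto simp: v_def card_gt_0_iff)
  \<comment> \<open>The quotient keeps the tuples lost in \<open>regular_tuple\<close> within
    \<open>\<epsilon>\<close>; the cap 1 is required by \<open>greedy_embedding\<close>.\<close>
  define d where "d = min 1 (\<epsilon> / (4 * real (k * k * m)))"
  have km: "0 < real (k * k * m)" using k m by simp
  have d: "0 < d" "d \<le> 1" using \<epsilon> km by (auto simp: d_def)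
  have d\<epsilon>: "real (k * k * m) * (4 * d) \<le> \<epsilon>"
  proof -
    have "d \<le> \<epsilon> / (4 * real (k * k * m))" by (simp add: d_def)
    then show ?thesis using km by (simp add: pos_le_divide_eq mult_ac)
  qed
  \<comment> \<open>At most \<open>v\<close> neighbours cost an \<open>\<eta>\<close> fraction of a
    cell each; together they use half of \<open>d ^ v\<close>.\<close>
  define \<eta> where "\<eta> = d ^ v / (2 * v)"
  have \<eta>: "0 < \<eta>" "\<eta> \<le> d ^ v" "v * \<eta> = d ^ v / 2"
    using d v by (auto simp: \<eta>_def field_simps)
  have "d ^ v \<le> d" using d v by (metis power_decreasing power_one_right Suc_leI One_nat_def less_imp_le)
  then have \<eta>d: "\<eta> \<le> d" using \<eta> by simp
  \<comment> \<open>At most \<open>m\<close> cliques pass through two given points, with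
    \<open>k\<close> vertices each.\<close>
  define K where "K = m * k"
  have "0 < d ^ v / 2" using d by simp
  \<comment> \<open>In cells of size \<open>L\<close> the remaining half of \<open>d ^ v\<close>
    outnumbers the forbidden points.\<close>
  then obtain L :: nat where L: "real (v + v * v * K) < L * (d ^ v / 2)"
    using reals_Archimedean3 by blast
  obtain n0 where n0: "\<forall>(X :: nat set) (H :: nat set set) q. finite X \<longrightarrow> finite H \<longrightarrow> n0 \<le> card X \<longrightarrow>
    (\<forall>h\<in>H. \<forall>i<k. q h i \<in> X) \<longrightarrow>
    (\<forall>i<k. \<forall>j<k. i \<noteq> j \<longrightarrow> (\<forall>x y. card {h \<in> H. q h i = x \<and> q h j = y} \<le> m)) \<longrightarrow>
    real (card H) > \<epsilon> * (card X)\<^sup>2 \<longrightarrow>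
    (\<exists>A. (\<forall>i<k. A i \<subseteq> X \<and> L \<le> card (A i)) \<and>
      (\<forall>i<k. \<forall>j<k. i \<noteq> j \<longrightarrow> lower_regular \<eta> d (link H q i j) (A i) (A j)))"
    by (rule exE[OF regular_tuple[OF k d(1) d\<epsilon> \<eta>(1) \<eta>d, where ?'v = nat and ?'h = "nat set" and L = L]])
  show ?thesis
  proof (intro exI[of _ n0] allI impI, rule ccontr)
    fix n H
    assume n: "n0 \<le> n" and unif: "uniform_hypergraph r n H" and free: "\<not> contains_berge V E n H"
      and "\<not> real (card H) \<le> \<epsilon> * (real n)\<^sup>2"
    then have big: "real (card H) > \<epsilon> * (card {0..<n})\<^sup>2" by simp
    have Hn: "\<And>h. h \<in> H \<Longrightarrow> h \<subseteq> {0..<n} \<and> card h = r" using unif by (auto simp: uniform_hypergraph_def)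
    have finH: "finite H" using Hn by (intro finite_subset[of H "Pow {0..<n}"]) auto
    have "\<forall>h\<in>H. \<exists>q. inj_on q {..<k} \<and> q ` {..<k} \<subseteq> h \<and>
        (\<forall>i<k. \<forall>j<k. i \<noteq> j \<longrightarrow> card {h' \<in> H. q i \<in> h' \<and> q j \<in> h'} < m)"
      unfolding m_def using Hn r finite_subset[of _ "{0..<n}"]
      by (intro ballI low_codegree_clique[OF g e _ _ _ _ free]) (auto simp: k_def)
    from bchoice[OF this] obtain q where qall: "\<forall>h\<in>H. inj_on (q h) {..<k} \<and> q h ` {..<k} \<subseteq> h \<and>
        (\<forall>i<k. \<forall>j<k. i \<noteq> j \<longrightarrow> card {h' \<in> H. q h i \<in> h' \<and> q h j \<in> h'} < m)" ..
    have q: "\<And>h. h \<in> H \<Longrightarrow> inj_on (q h) {..<k}" "\<And>h. h \<in> H \<Longrightarrow> q h ` {..<k} \<subseteq> h"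
      "\<And>h i j. h \<in> H \<Longrightarrow> i < k \<Longrightarrow> j < k \<Longrightarrow> i \<noteq> j \<Longrightarrow> card {h' \<in> H. q h i \<in> h' \<and> q h j \<in> h'} < m"
      using qall by blast+
    have pair: "card {h \<in> H. x \<in> q h ` {..<k} \<and> y \<in> q h ` {..<k}} \<le> m" if "x \<noteq> y" for x y
    \<comment> \<open>Small codegree is known only for pairs lying in some clique; for any other
      pair the set is empty.\<close>
    proof (cases "{h \<in> H. x \<in> q h ` {..<k} \<and> y \<in> q h ` {..<k}} = {}")
      case True
      then show ?thesis by (simp only: card.empty)
    next
      case False
      then obtain h i j where h: "h \<in> H" "i < k" "j < k" "x = q h i" "y = q h j" by auto
      have "card {h \<in> H. x \<in> q h ` {..<k} \<and> y \<in> q h ` {..<k}} \<le> card {h' \<in> H. x \<in> h' \<and> y \<in> h'}"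
        using finH q(2) by (intro card_mono) auto
      also have "\<dots> < m" using q(3)[of h i j] h that by auto
      finally show ?thesis by simp
    qed
    have codeg: "card {h \<in> H. q h i = x \<and> q h j = y} \<le> m" if ij: "i < k" "j < k" "i \<noteq> j" for i j x y
    proof (cases "x = y")
      case True
      then have "{h \<in> H. q h i = x \<and> q h j = y} = {}"
        using q(1) ij by (auto dest: inj_onD)
      then show ?thesis by (simp only: card.empty)
    next
      case False
      have "card {h \<in> H. q h i = x \<and> q h j = y} \<le> card {h \<in> H. x \<in> q h ` {..<k} \<and> y \<in> q h ` {..<k}}"
        using finH ij by (intro card_mono) auto
      then show ?thesis using pair[OF False] by simp
    qed
    have qX: "\<forall>h\<in>H. \<forall>i<k. q h i \<in> {0..<n}" using q(2) Hn by blast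
    have "\<exists>A. (\<forall>i<k. A i \<subseteq> {0..<n} \<and> L \<le> card (A i)) \<and>
      (\<forall>i<k. \<forall>j<k. i \<noteq> j \<longrightarrow> lower_regular \<eta> d (link H q i j) (A i) (A j))"
      using n codeg
      by (intro n0[THEN spec, THEN spec, THEN spec, THEN mp, THEN mp, THEN mp, THEN mp, THEN mp, THEN mp]
          finH qX big) simp_all
    then obtain A where A: "\<And>i. i < k \<Longrightarrow> A i \<subseteq> {0..<n} \<and> L \<le> card (A i)"
      "\<And>i j. i < k \<Longrightarrow> j < k \<Longrightarrow> i \<noteq> j \<Longrightarrow> lower_regular \<eta> d (link H q i j) (A i) (A j)"
      by blast
    define \<L> where "\<L> = (\<lambda>h. q h ` {..<k}) ` H"
    have lines: "finite (\<Union>{l \<in> \<L>. x \<in> l \<and> y \<in> l}) \<and> card (\<Union>{l \<in> \<L>. x \<in> l \<and> y \<in> l}) \<le> K"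
      if "x \<noteq> y" for x y
    proof -
      let ?P = "{h \<in> H. x \<in> q h ` {..<k} \<and> y \<in> q h ` {..<k}}"
      have eq: "\<Union>{l \<in> \<L>. x \<in> l \<and> y \<in> l} = (\<Union>h\<in>?P. q h ` {..<k})" unfolding \<L>_def by blast
      have finP: "finite ?P" using finH by simp
      have "card (\<Union>h\<in>?P. q h ` {..<k}) \<le> (\<Sum>h\<in>?P. card (q h ` {..<k}))" by (rule card_UN_le[OF finP])
      also have "\<dots> \<le> (\<Sum>h\<in>?P. k)"
        by (intro sum_mono) (metis card_image_le card_lessThan finite_lessThan)
      also have "\<dots> \<le> K" using pair[OF that] by (simp add: K_def)
      finally show ?thesis unfolding eq using finP by blast
    qed
    have ck: "\<And>u. u \<in> V \<Longrightarrow> c u < k" using c by auto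
    have "\<exists>\<phi>. inj_on \<phi> V \<and> (\<forall>u\<in>V. \<phi> u \<in> A (c u)) \<and>
      (\<forall>u\<in>V. \<forall>w\<in>V. u \<noteq> w \<longrightarrow> {u, w} \<in> E \<longrightarrow> (\<phi> u, \<phi> w) \<in> link H q (c u) (c w)) \<and>
      (\<forall>l\<in>\<L>. \<forall>u\<in>V. \<forall>v\<in>V. \<forall>w\<in>V. u \<noteq> v \<longrightarrow> v \<noteq> w \<longrightarrow> u \<noteq> w \<longrightarrow> \<not> (\<phi> u \<in> l \<and> \<phi> v \<in> l \<and> \<phi> w \<in> l))"
    proof (rule greedy_embedding[where k = k and \<eta> = \<eta> and d = d and K = K])
      show "c u \<noteq> c w" if "u \<noteq> w" "{u, w} \<in> E" for u w using proper[of "{u, w}" u w] that by simp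
      show "finite (A i)" if "i < k" for i using A(1)[OF that] finite_subset by blast
      show "(y, x) \<in> link H q j i" if "(x, y) \<in> link H q i j" for i j x y
        using that by (auto simp: link_def)
      show "real (card V + card V * card V * K) < (d ^ card V - card V * \<eta>) * card (A i)" if "i < k" for i
      proof -
        have "real (v + v * v * K) < L * (d ^ v / 2)" by (rule L)
        also have "\<dots> \<le> card (A i) * (d ^ v / 2)"
          using A(1)[OF that] d by (intro mult_right_mono) auto
        also have "\<dots> = (d ^ v - v * \<eta>) * card (A i)" using \<eta>(3) by (simp add: mult.commute)
        finally show ?thesis by (simp only: v_def)
      qed
    qed (use finV ck A(2) lines d \<eta> in \<open>auto simp: v_def\<close>)
    then obtain \<phi> where "inj_on \<phi> V" and \<phi>A: "\<forall>u\<in>V. \<phi> u \<in> A (c u)"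
      and \<phi>R: "\<forall>u\<in>V. \<forall>w\<in>V. u \<noteq> w \<longrightarrow> {u, w} \<in> E \<longrightarrow> (\<phi> u, \<phi> w) \<in> link H q (c u) (c w)"
      and \<phi>L: "\<forall>l\<in>\<L>. \<forall>u\<in>V. \<forall>v\<in>V. \<forall>w\<in>V. u \<noteq> v \<longrightarrow> v \<noteq> w \<longrightarrow> u \<noteq> w \<longrightarrow>
        \<not> (\<phi> u \<in> l \<and> \<phi> v \<in> l \<and> \<phi> w \<in> l)"
      by (elim exE conjE)
    from this(1) have "contains_berge V E n H"
    proof (rule contains_berge_of_embedding[OF g, where L = "\<lambda>h. q h ` {..<k}"])
      show "\<phi> ` V \<subseteq> {0..<n}" using \<phi>A A(1) ck by blast
      show "\<exists>h\<in>H. \<phi> u \<in> q h ` {..<k} \<and> \<phi> w \<in> q h ` {..<k}"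
        if "u \<in> V" "w \<in> V" "u \<noteq> w" "{u, w} \<in> E" for u w
        using \<phi>R[rule_format, OF that] ck that(1,2) by (auto simp: link_def)
      show "\<not> (\<phi> u \<in> q h ` {..<k} \<and> \<phi> v \<in> q h ` {..<k} \<and> \<phi> w \<in> q h ` {..<k})"
        if "h \<in> H" "u \<in> V" "v \<in> V" "w \<in> V" "u \<noteq> v" "v \<noteq> w" "u \<noteq> w" for h u v w
      proof -
        have "q h ` {..<k} \<in> \<L>" using that(1) by (simp add: \<L>_def)
        from \<phi>L[rule_format, OF this that(2-)] show ?thesis .
      qed
    qed (use q(2) in auto)
    then show False using free by simp
  qed
qed

theorem theorem4:
  fixes V :: "'a set" and E :: "'a set set" and e :: "'a set"
  assumes "graph V E" and "e \<in> E"
  shows "uniformity_threshold V E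
           \<le> ramsey_number {0..<chromatic_number V E} (complete_graph_edges (chromatic_number V E))
                            V (E - {e})"
proof -
  have "(\<lambda>n. real (ex_berge r n V E)) \<in> o(\<lambda>n. real n ^ 2)"
    if r: "ramsey_number {0..<chromatic_number V E} (complete_graph_edges (chromatic_number V E))
            V (E - {e}) \<le> r" for r
  proof (rule landau_o.smallI)
    fix \<epsilon> :: real assume "0 < \<epsilon>"
    from berge_free_sparse[OF assms this r] obtain n0 where n0: "\<And>n H. n0 \<le> n \<Longrightarrow>
        uniform_hypergraph r n H \<Longrightarrow> \<not> contains_berge V E n H \<Longrightarrow> real (card H) \<le> \<epsilon> * (real n)\<^sup>2"
      by blast
    show "\<forall>\<^sub>F n in sequentially. norm (real (ex_berge r n V E)) \<le> \<epsilon> * norm (real n ^ 2)"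
      unfolding eventually_sequentially
    proof (intro exI[of _ n0] allI impI)
      fix n assume n: "n0 \<le> n"
      let ?S = "{card H | H. uniform_hypergraph r n H \<and> \<not> contains_berge V E n H}"
      have "?S \<subseteq> card ` Pow (Pow {0..<n})" by (auto simp: uniform_hypergraph_def)
      then have fin: "finite ?S" by (rule finite_subset) simp
      \<comment> \<open>As \<open>E\<close> is nonempty, the hypergraph without hyperedges is
        Berge-free. So the maximum ranges over a nonempty finite set and is attained.\<close>
      have "uniform_hypergraph r n {}" "\<not> contains_berge V E n {}"
        using assms(2) by (auto simp: uniform_hypergraph_def contains_berge_def)
      then have "?S \<noteq> {}" by blast
      then have "ex_berge r n V E \<in> ?S" unfolding ex_berge_def using fin Max_in by blast
      then show "norm (real (ex_berge r n V E)) \<le> \<epsilon> * norm (real n ^ 2)" using n0[OF n] by auto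
    qed
  qed
  then show ?thesis unfolding uniformity_threshold_def by (intro Least_le) blast
qed

end
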